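(* Let $(p_n)_{n\ge 1}$ be a sequence in $(1,+\infty)$ with $\lim_n p_n=1$. Then the Musielak-Orlicz (Nakano) sequence space $\ell^{p_n}$ endowed with the Luxemburg norm has the fixed point property (FPP).
   Context: For $(p_n)\subset(1,+\infty)$, define on real sequences $x=(x_n)$ the modular $\rho(x)=\sum_{n=1}^\infty|x_n|^{p_n}$. The space $\ell^{p_n}$ consists of all real sequences $x$ with $\rho(x/\lambda)<\infty$ for some $\lambda>0$, and the Luxemburg norm is $\|x\|=\inf\{\alpha>0:\rho(x/\alpha)\le 1\}$. A Banach space $X$ has the FPP if for every nonempty closed convex bounded $C\subset X$, every nonexpansive $T:C\to C$ (i.e. $\|Tx-Ty\|\le\|x-y\|$ for all $x,y\in C$) has a fixed point. *)

theory Defs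
  imports "HOL-Analysis.Analysis" "HOL-Library.Function_Algebras"
begin

text \<open>Functions form a real vector space pointwise; the addition is the one of
  Function_Algebras.\<close>

instantiation "fun" :: (type, real_vector) real_vector
begin

definition scaleR_fun :: "real \<Rightarrow> ('a \<Rightarrow> 'b) \<Rightarrow> 'a \<Rightarrow> 'b"
  where "scaleR_fun c f = (\<lambda>x. c *\<^sub>R f x)"

instance
  by standard (simp_all add: scaleR_fun_def fun_eq_iff scaleR_add_right scaleR_add_left)

end

text \<open>The space below depends on the sequence of exponents, so it cannot be a type of class
  \<^class>\<open>banach\<close>. Normed spaces are therefore linear subspaces \<open>X\<close> of a real vector space
  together with a function \<open>N\<close> whose values matter only on \<open>X\<close>.\<close>

definition normed_on :: "'a::real_vector set \<Rightarrow> ('a \<Rightarrow> real) \<Rightarrow> bool" where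
  "normed_on X N \<longleftrightarrow> subspace X \<and>
     (\<forall>x\<in>X. 0 \<le> N x \<and> (N x = 0 \<longleftrightarrow> x = 0)) \<and>
     (\<forall>c. \<forall>x\<in>X. N (c *\<^sub>R x) = \<bar>c\<bar> * N x) \<and>
     (\<forall>x\<in>X. \<forall>y\<in>X. N (x + y) \<le> N x + N y)"

text \<open>The value 0 outside \<open>X\<close> is there because the locale \<^locale>\<open>Metric_space\<close> demands
  nonnegativity and symmetry on the whole type; on \<open>X\<close> this is the norm metric.\<close>

definition norm_dist :: "'a::real_vector set \<Rightarrow> ('a \<Rightarrow> real) \<Rightarrow> 'a \<Rightarrow> 'a \<Rightarrow> real" where
  "norm_dist X N x y = (if x \<in> X \<and> y \<in> X then N (x - y) else 0)"

lemma Metric_space_norm_dist: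
  assumes "normed_on X N"
  shows "Metric_space X (norm_dist X N)"
proof
  have X: "subspace X"
    and nn: "\<And>x. x \<in> X \<Longrightarrow> 0 \<le> N x"
    and z: "\<And>x. x \<in> X \<Longrightarrow> N x = 0 \<longleftrightarrow> x = 0"
    and h: "\<And>c x. x \<in> X \<Longrightarrow> N (c *\<^sub>R x) = \<bar>c\<bar> * N x"
    and t: "\<And>x y. x \<in> X \<Longrightarrow> y \<in> X \<Longrightarrow> N (x + y) \<le> N x + N y"
    using assms unfolding normed_on_def by auto
  have d: "x - y \<in> X" if "x \<in> X" "y \<in> X" for x y
    using X that by (rule subspace_diff)
  show "0 \<le> norm_dist X N x y" for x y
    by (simp add: norm_dist_def nn d)
  show "norm_dist X N x y = norm_dist X N y x" for x y
    using h[of "x - y" "-1"] d[of x y] by (auto simp: norm_dist_def)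
  show "norm_dist X N x y = 0 \<longleftrightarrow> x = y" if "x \<in> X" "y \<in> X" for x y
    using that by (simp add: norm_dist_def z d)
  show "norm_dist X N x w \<le> norm_dist X N x y + norm_dist X N y w"
    if "x \<in> X" "y \<in> X" "w \<in> X" for x y w
    using that t[of "x - y" "y - w"] by (simp add: norm_dist_def d)
qed

definition banach_on :: "'a::real_vector set \<Rightarrow> ('a \<Rightarrow> real) \<Rightarrow> bool" where
  "banach_on X N \<longleftrightarrow> normed_on X N \<and> Metric_space.mcomplete X (norm_dist X N)"

text \<open>Closed and bounded are understood in the norm metric. The map \<open>T\<close> is a total function of
  which only the restriction to \<open>C\<close> is used.\<close>

definition has_FPP :: "'a::real_vector set \<Rightarrow> ('a \<Rightarrow> real) \<Rightarrow> bool" where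
  "has_FPP X N \<longleftrightarrow> banach_on X N \<and>
     (\<forall>C T. C \<noteq> {} \<and> closedin (Metric_space.mtopology X (norm_dist X N)) C \<and> convex C \<and>
        Metric_space.mbounded X (norm_dist X N) C \<and> T \<in> C \<rightarrow> C \<and>
        (\<forall>x\<in>C. \<forall>y\<in>C. N (T x - T y) \<le> N (x - y)) \<longrightarrow>
        (\<exists>x\<in>C. T x = x))"

text \<open>Sequences are indexed from 0. The modular may be infinite, hence its type.\<close>

definition modular :: "(nat \<Rightarrow> real) \<Rightarrow> (nat \<Rightarrow> real) \<Rightarrow> ennreal" where
  "modular p x = (\<Sum>n. ennreal (\<bar>x n\<bar> powr p n))"

definition nakano_space :: "(nat \<Rightarrow> real) \<Rightarrow> (nat \<Rightarrow> real) set" where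
  "nakano_space p = {x. \<exists>l>0. modular p (\<lambda>n. x n / l) < \<infinity>}"

definition luxemburg_norm :: "(nat \<Rightarrow> real) \<Rightarrow> (nat \<Rightarrow> real) \<Rightarrow> real" where
  "luxemburg_norm p x = Inf {a. 0 < a \<and> modular p (\<lambda>n. x n / a) \<le> 1}"

end

theory Submission
  imports Defs "HOL-Complex_Analysis.Great_Picard"
begin

text \<open>Write \<open>\<rho>\<close> for the modular and call a sequence of vectors vanishing with mass \<open>r\<close> if its
  coordinates tend to 0 and its modulars tend to \<open>r\<close>. Such a sequence lives more and more on
  coordinates whose exponents are close to 1, where \<open>\<rho>\<close> is almost the \<open>l\<^sup>1\<close> norm. Hence for
  \<open>c > 0\<close>, a fixed vector \<open>v\<close> and a sequence \<open>w\<close> vanishing with mass \<open>r\<close>, the modulars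
  \<open>\<rho>(c (w n + v))\<close> tend to \<open>c r + \<rho>(c v)\<close> (\<open>rho_scaled_add_vanishing\<close>): at infinity the space
  looks like \<open>l\<^sup>1\<close>. At a fixed vector, however, all exponents exceed 1, so \<open>\<rho>(t v) = o(t)\<close> as \<open>t\<close>
  tends to 0 (\<open>rho_sublinear_at_0\<close>). The theorem comes from the gap between these two behaviours.

  Let \<open>T\<close> be a nonexpansive self-map of a bounded convex set \<open>C\<close>. There are approximate fixed
  point sequences \<open>z\<close> in \<open>C\<close>, and after passing to a subsequence \<open>z - x\<close> vanishes with some mass
  \<open>r\<close> for some \<open>x\<close> in the space (\<open>afps_exists\<close>). If the set of points \<open>y\<close> of \<open>C\<close> with
  \<open>limsup \<parallel>z n - y\<parallel> \<le> s\<close> is nonempty, it is again convex and invariant and contains further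
  approximate fixed point sequences; if one of them has limit \<open>w\<close> and mass \<open>q\<close>, then
  \<open>(r + q)/s' + \<rho>((x - w)/s') \<le> 1\<close> for all \<open>s' > s\<close>, because the two masses add up
  (\<open>lim_ball_limit_bound\<close>).

  The core is that the infimum of the masses over \<open>C\<close> is 0 (\<open>rad_zero\<close>). If it were some \<open>r0 > 0\<close>,
  then for an almost minimal \<open>(z1, x1, r1)\<close> and \<open>s\<close> slightly above \<open>2 r1\<close> the bound above leaves
  almost no room for \<open>\<rho>((x1 - x)/s)\<close>: the limits \<open>x\<close> of all approximate fixed point sequences in
  the resulting set \<open>D\<close> are close to \<open>x1\<close>. Fix a point \<open>u\<close> of \<open>D\<close> and then a small \<open>t > 0\<close>, and
  only now an almost minimal \<open>(z, x, r)\<close> in \<open>D\<close>. The point \<open>(1 - t) z m + t u\<close> is at asymptotic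
  distance less than \<open>2 r (1 - t/8)\<close> from \<open>z\<close>: replacing \<open>z m\<close> by it gains the mass \<open>t r\<close>, while
  the term \<open>\<rho>(t (u - x)/s)\<close> that has to be paid for is at most \<open>t/4\<close>, by sublinearity for \<open>u - x1\<close>
  and by closeness for \<open>x1 - x\<close>. So there is an approximate fixed point sequence in \<open>D\<close> with mass
  at most \<open>r - t r/4\<close>, which is below the infimum over \<open>D\<close>. That \<open>t\<close> can be chosen before \<open>x\<close> is
  known is the point of passing to \<open>D\<close>.

  Since all these infima vanish, there are nested invariant sets whose diameters tend to 0, and
  completeness

yields a fixed point.\<close>

section \<open>The modular\<close>

lemma scaleR_fun_apply [simp]: "(c *\<^sub>R f) x = c *\<^sub>R f x"
  by (simp add: scaleR_fun_def)

text \<open>The convexity of \<open>powr\<close> on the open half-line, extended to 0 and to both signs. When an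
  argument is 0 the inequality rests on \<open>s powr p \<le> s\<close> for \<open>s\<close> in the unit interval.\<close>

lemma powr_convex_comb:
  fixes a b t p :: real
  assumes "1 \<le> p" "0 \<le> t" "t \<le> 1"
  shows "\<bar>(1 - t) * a + t * b\<bar> powr p \<le> (1 - t) * \<bar>a\<bar> powr p + t * \<bar>b\<bar> powr p"
proof -
  have small: "s powr p \<le> s" if "0 \<le> s" "s \<le> 1" for s :: real
    using powr_mono'[of 1 p s] that assms by auto
  have nonneg: "((1 - t) * x + t * y) powr p \<le> (1 - t) * x powr p + t * y powr p"
    if "0 \<le> x" "0 \<le> y" for x y :: real
  proof (cases "x = 0 \<or> y = 0")
    case True
    then show ?thesis
      using that assms mult_right_mono[OF small[of t], of "y powr p"]
        mult_right_mono[OF small[of "1 - t"], of "x powr p"] by (auto simp: powr_mult)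
  next
    case False
    then show ?thesis
      using that assms convex_onD[OF powr_convex[of p], of t x y] by auto
  qed
  have "\<bar>(1 - t) * a + t * b\<bar> \<le> (1 - t) * \<bar>a\<bar> + t * \<bar>b\<bar>"
    using assms abs_triangle_ineq[of "(1 - t) * a" "t * b"] by (simp add: abs_mult)
  then have "\<bar>(1 - t) * a + t * b\<bar> powr p \<le> ((1 - t) * \<bar>a\<bar> + t * \<bar>b\<bar>) powr p"
    using assms by (intro powr_mono2) auto
  with nonneg[of "\<bar>a\<bar>" "\<bar>b\<bar>"] show ?thesis by simp
qed

text \<open>Outside the space the series diverges and the value means nothing.\<close>

definition rho :: "(nat \<Rightarrow> real) \<Rightarrow> (nat \<Rightarrow> real) \<Rightarrow> real" where
  "rho p x = (\<Sum>k. \<bar>x k\<bar> powr p k)"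

locale nakano_to_one =
  fixes p :: "nat \<Rightarrow> real"
  assumes p_gt1: "1 < p k" and p_lim: "p \<longlonglongrightarrow> 1"
begin

abbreviation X where "X \<equiv> nakano_space p"
abbreviation N where "N \<equiv> luxemburg_norm p"
abbreviation \<rho> where "\<rho> \<equiv> rho p"

definition P :: real where "P = (SUP k. p k)"

lemma p_le_P: "p k \<le> P"
proof -
  have "bdd_above (range p)"
    by (rule bounded_imp_bdd_above[OF convergent_imp_bounded[OF p_lim]])
  then show ?thesis unfolding P_def by (rule cSUP_upper[OF UNIV_I])
qed

lemma P_gt1: "1 < P"
  using p_gt1[of 0] p_le_P[of 0] by simp

lemma p_nonneg: "0 \<le> p k" and p_pos: "0 < p k" and p_ge1: "1 \<le> p k"
  using p_gt1[of k] by auto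

lemma powr_scale_le:
  assumes "1 \<le> c" shows "c powr p k \<le> c powr P"
  using assms p_le_P by (intro powr_mono) auto

text \<open>Bounded exponents make the modular satisfy the \<open>\<Delta>\<^sub>2\<close> condition: rescaling a vector changes
  its modular by a bounded factor. So finiteness for one scale gives finiteness for all.\<close>

lemma X_summable: "x \<in> X \<longleftrightarrow> summable (\<lambda>k. \<bar>x k\<bar> powr p k)"
proof
  assume "x \<in> X"
  then obtain l where l: "l > 0" "modular p (\<lambda>n. x n / l) < \<infinity>"
    by (auto simp: nakano_space_def)
  have s: "summable (\<lambda>k. \<bar>x k / l\<bar> powr p k)"
    using l(2) by (intro summable_suminf_not_top) (auto simp: modular_def)
  define c where "c = max 1 l"
  have "\<bar>x k\<bar> powr p k \<le> c powr P * \<bar>x k / l\<bar> powr p k" for k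
  proof -
    have "\<bar>x k\<bar> powr p k = l powr p k * \<bar>x k / l\<bar> powr p k"
      using l by (simp flip: powr_mult)
    also have "l powr p k \<le> c powr p k"
      using l p_nonneg by (intro powr_mono2) (auto simp: c_def)
    also have "c powr p k \<le> c powr P" by (rule powr_scale_le) (simp add: c_def)
    finally show ?thesis by (simp add: mult_right_mono)
  qed
  then show "summable (\<lambda>k. \<bar>x k\<bar> powr p k)"
    by (intro summable_comparison_test'[OF summable_mult[OF s], of 0]) simp
next
  assume "summable (\<lambda>k. \<bar>x k\<bar> powr p k)"
  then have "modular p (\<lambda>n. x n / 1) < \<infinity>"
    by (simp add: modular_def suminf_ennreal2 less_top[symmetric])
  then show "x \<in> X" unfolding nakano_space_def using zero_less_one by blast
qed

lemma modular_le_iff: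
  assumes "0 \<le> M"
  shows "modular p x \<le> ennreal M \<longleftrightarrow> x \<in> X \<and> \<rho> x \<le> M"
proof (cases "x \<in> X")
  case True
  then show ?thesis
    using assms by (auto simp: X_summable modular_def rho_def suminf_ennreal2 ennreal_le_iff)
next
  case False
  then have "modular p x = top"
    using summable_suminf_not_top[of "\<lambda>k. \<bar>x k\<bar> powr p k"]
    unfolding modular_def X_summable by fastforce
  then have "\<not> modular p x \<le> ennreal M" by (simp add: top_unique)
  with False show ?thesis by blast
qed

lemma scale_mem: assumes "x \<in> X" shows "c *\<^sub>R x \<in> X"
proof -
  have le: "\<bar>(c *\<^sub>R x) k\<bar> powr p k \<le> max 1 \<bar>c\<bar> powr P * \<bar>x k\<bar> powr p k" for k
  proof -
    have "\<bar>c\<bar> powr p k \<le> max 1 \<bar>c\<bar> powr p k" using p_nonneg by (intro powr_mono2) auto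
    also have "\<dots> \<le> max 1 \<bar>c\<bar> powr P" by (rule powr_scale_le) simp
    finally show ?thesis by (simp add: abs_mult powr_mult mult_right_mono)
  qed
  have "summable (\<lambda>k. max 1 \<bar>c\<bar> powr P * \<bar>x k\<bar> powr p k)"
    using assms by (simp add: X_summable summable_mult)
  then have "summable (\<lambda>k. \<bar>(c *\<^sub>R x) k\<bar> powr p k)"
    by (rule summable_comparison_test'[of _ 0]) (use le in simp)
  then show ?thesis unfolding X_summable .
qed

lemma convex_comb_mem_rho:
  assumes "x \<in> X" "y \<in> X" "0 \<le> t" "t \<le> 1"
  shows "(1 - t) *\<^sub>R x + t *\<^sub>R y \<in> X"
    and "\<rho> ((1 - t) *\<^sub>R x + t *\<^sub>R y) \<le> (1 - t) * \<rho> x + t * \<rho> y"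
proof -
  let ?f = "\<lambda>k. (1 - t) * \<bar>x k\<bar> powr p k + t * \<bar>y k\<bar> powr p k"
  have s: "summable ?f" using assms by (auto simp: X_summable intro!: summable_add summable_mult)
  have le: "\<bar>((1 - t) *\<^sub>R x + t *\<^sub>R y) k\<bar> powr p k \<le> ?f k" for k
    using powr_convex_comb[OF p_ge1 assms(3,4)] by simp
  have s': "summable (\<lambda>k. \<bar>((1 - t) *\<^sub>R x + t *\<^sub>R y) k\<bar> powr p k)"
    by (rule summable_comparison_test'[OF s, of 0]) (use le in auto)
  then show "(1 - t) *\<^sub>R x + t *\<^sub>R y \<in> X" by (simp add: X_summable)
  have "\<rho> ((1 - t) *\<^sub>R x + t *\<^sub>R y) \<le> suminf ?f"
    unfolding rho_def by (rule suminf_le[OF le s' s])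
  also have "\<dots> = (1 - t) * \<rho> x + t * \<rho> y"
    using assms by (simp add: rho_def X_summable suminf_add[symmetric] suminf_mult summable_mult)
  finally show "\<rho> ((1 - t) *\<^sub>R x + t *\<^sub>R y) \<le> (1 - t) * \<rho> x + t * \<rho> y" .
qed

lemma subspace_X: "subspace X"
proof (rule subspaceI)
  show "0 \<in> X" by (simp add: X_summable)
  show "c *\<^sub>R x \<in> X" if "x \<in> X" for c x using scale_mem[OF that] .
  show "x + y \<in> X" if "x \<in> X" "y \<in> X" for x y
  proof -
    have "x + y = 2 *\<^sub>R ((1 - 1/2) *\<^sub>R x + (1/2) *\<^sub>R y)" by (simp add: scaleR_add_right)
    with convex_comb_mem_rho(1)[OF that, of "1/2"] show ?thesis by (simp add: scale_mem)
  qed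
qed

lemmas add_mem = subspace_add[OF subspace_X]
  and diff_mem = subspace_diff[OF subspace_X]
  and neg_mem = subspace_neg[OF subspace_X]

lemma rho_nonneg: "x \<in> X \<Longrightarrow> 0 \<le> \<rho> x"
  by (simp add: rho_def X_summable suminf_nonneg)

lemma rho_zero [simp]: "\<rho> 0 = 0"
  by (simp add: rho_def)

lemma rho_minus: "\<rho> (- x) = \<rho> x"
  by (simp add: rho_def)

lemma rho_diff_commute: "\<rho> (c *\<^sub>R (x - y)) = \<rho> (c *\<^sub>R (y - x))"
  by (subst rho_minus[symmetric]) (simp add: scaleR_diff_right)

lemma coord_le_rho: "x \<in> X \<Longrightarrow> \<bar>x k\<bar> powr p k \<le> \<rho> x"
  using sum_le_suminf[of "\<lambda>k. \<bar>x k\<bar> powr p k" "{k}"] by (simp add: rho_def X_summable)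

lemma rho_shrink:
  assumes "x \<in> X" "0 \<le> t" "t \<le> 1" shows "\<rho> (t *\<^sub>R x) \<le> t * \<rho> x"
  using convex_comb_mem_rho(2)[of 0 x t] assms subspace_0[OF subspace_X] by simp

lemma rho_stretch:
  assumes "x \<in> X" "1 \<le> c" shows "\<rho> (c *\<^sub>R x) \<le> c powr P * \<rho> x"
proof -
  have "\<rho> (c *\<^sub>R x) \<le> (\<Sum>k. c powr P * \<bar>x k\<bar> powr p k)"
    unfolding rho_def
  proof (rule suminf_le)
    show "\<bar>(c *\<^sub>R x) k\<bar> powr p k \<le> c powr P * \<bar>x k\<bar> powr p k" for k
      using mult_right_mono[OF powr_scale_le[OF assms(2)], of "\<bar>x k\<bar> powr p k" k] assms(2)
      by (simp add: abs_mult powr_mult)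
  qed (use assms(1) scale_mem[OF assms(1), of c] in \<open>simp_all add: X_summable summable_mult\<close>)
  also have "\<dots> = c powr P * \<rho> x"
    using assms(1) by (simp add: rho_def X_summable suminf_mult)
  finally show ?thesis .
qed

lemma rho_mono_scale:
  assumes "x \<in> X" "0 \<le> s" "s \<le> t" shows "\<rho> (s *\<^sub>R x) \<le> \<rho> (t *\<^sub>R x)"
  unfolding rho_def
proof (rule suminf_le)
  show "\<bar>(s *\<^sub>R x) k\<bar> powr p k \<le> \<bar>(t *\<^sub>R x) k\<bar> powr p k" for k
    using assms p_nonneg by (intro powr_mono2) (auto simp: abs_mult mult_right_mono)
qed (use scale_mem[OF assms(1), of s] scale_mem[OF assms(1), of t] in \<open>simp_all add: X_summable\<close>)

lemma rho_add_le:
  assumes "x \<in> X" "y \<in> X" shows "\<rho> (x + y) \<le> 2 powr P * (\<rho> x + \<rho> y)"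
proof -
  have "x + y = (1 - 1/2) *\<^sub>R (2 *\<^sub>R x) + (1/2) *\<^sub>R (2 *\<^sub>R y)" by simp
  then have "\<rho> (x + y) \<le> (1/2) * \<rho> (2 *\<^sub>R x) + (1/2) * \<rho> (2 *\<^sub>R y)"
    using convex_comb_mem_rho(2)[of "2 *\<^sub>R x" "2 *\<^sub>R y" "1/2"] assms by (simp add: scale_mem)
  also have "\<dots> \<le> (1/2) * (2 powr P * \<rho> x) + (1/2) * (2 powr P * \<rho> y)"
    using rho_stretch[of x 2] rho_stretch[of y 2] assms by simp
  also have "\<dots> \<le> 2 powr P * (\<rho> x + \<rho> y)"
    using mult_nonneg_nonneg[OF powr_ge_zero[of 2 P] rho_nonneg[OF assms(1)]]
      mult_nonneg_nonneg[OF powr_ge_zero[of 2 P] rho_nonneg[OF assms(2)]]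
    by (simp add: distrib_left)
  finally show ?thesis .
qed

text \<open>Every finite partial sum of the modular is continuous in the coordinates. This gives
  completeness of the space, and places coordinatewise limits of bounded sequences in it.\<close>

lemma rho_Fatou:
  assumes "\<And>n. y n \<in> X" and "\<And>k. (\<lambda>n. y n k) \<longlonglongrightarrow> z k"
    and "\<forall>\<^sub>F n in sequentially. \<rho> (y n) \<le> M"
  shows "z \<in> X" and "\<rho> z \<le> M"
proof -
  have part: "(\<Sum>k<K. \<bar>z k\<bar> powr p k) \<le> M" for K
  proof (rule tendsto_upperbound)
    show "(\<lambda>n. \<Sum>k<K. \<bar>y n k\<bar> powr p k) \<longlonglongrightarrow> (\<Sum>k<K. \<bar>z k\<bar> powr p k)"
      by (intro tendsto_sum tendsto_powr2 tendsto_rabs assms(2) tendsto_const) (use p_pos in auto)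
    show "\<forall>\<^sub>F n in sequentially. (\<Sum>k<K. \<bar>y n k\<bar> powr p k) \<le> M"
      using assms(3)
    proof eventually_elim
      case (elim n)
      then show ?case
        using sum_le_suminf[of "\<lambda>k. \<bar>y n k\<bar> powr p k" "{..<K}"] assms(1)[of n]
        by (simp add: rho_def X_summable)
    qed
  qed simp
  then show "z \<in> X" unfolding X_summable by (intro summableI_nonneg_bounded) auto
  then show "\<rho> z \<le> M" unfolding rho_def X_summable by (rule suminf_le_const[OF _ part])
qed

section \<open>The Luxemburg norm\<close>

lemma N_eq_Inf: "N x = Inf {a. 0 < a \<and> (1/a) *\<^sub>R x \<in> X \<and> \<rho> ((1/a) *\<^sub>R x) \<le> 1}"
proof -
  have eq: "(\<lambda>n. x n / a) = (1/a) *\<^sub>R x" for a by (rule ext) simp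
  have "modular p (\<lambda>n. x n / a) \<le> 1 \<longleftrightarrow> (1/a) *\<^sub>R x \<in> X \<and> \<rho> ((1/a) *\<^sub>R x) \<le> 1" for a
    unfolding eq using modular_le_iff[of 1 "(1/a) *\<^sub>R x"] unfolding ennreal_1 by (metis zero_le_one)
  then show ?thesis unfolding luxemburg_norm_def by (simp only:)
qed

lemma N_le:
  assumes "x \<in> X" "0 < a" "\<rho> ((1/a) *\<^sub>R x) \<le> 1" shows "N x \<le> a"
  unfolding N_eq_Inf
proof (rule cInf_lower)
  show "a \<in> {a. 0 < a \<and> (1/a) *\<^sub>R x \<in> X \<and> \<rho> ((1/a) *\<^sub>R x) \<le> 1}"
    using assms scale_mem[OF assms(1), of "1/a"] by blast
  show "bdd_below {a. 0 < a \<and> (1/a) *\<^sub>R x \<in> X \<and> \<rho> ((1/a) *\<^sub>R x) \<le> 1}"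
    by (rule bdd_belowI[of _ 0]) (blast intro: less_imp_le)
qed

lemma N_set_nonempty:
  assumes "x \<in> X" shows "{a. 0 < a \<and> (1/a) *\<^sub>R x \<in> X \<and> \<rho> ((1/a) *\<^sub>R x) \<le> 1} \<noteq> {}"
proof -
  define a where "a = \<rho> x + 1"
  have a: "a \<ge> 1" using rho_nonneg[OF assms] by (simp add: a_def)
  have "\<rho> ((1/a) *\<^sub>R x) \<le> (1/a) * \<rho> x" using a by (intro rho_shrink assms) auto
  also have "\<dots> \<le> 1" using a by (simp add: a_def)
  finally have "\<rho> ((1/a) *\<^sub>R x) \<le> 1" .
  moreover have "0 < a" using a by simp
  ultimately show ?thesis using scale_mem[OF assms, of "1/a"] by blast
qed

lemma N_nonneg: assumes "x \<in> X" shows "0 \<le> N x"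
  unfolding N_eq_Inf
  by (rule cInf_greatest[OF N_set_nonempty[OF assms]]) (blast intro: less_imp_le)

lemma rho_le_1:
  assumes "x \<in> X" "N x < a" shows "\<rho> ((1/a) *\<^sub>R x) \<le> 1"
proof -
  obtain b where b: "0 < b" "b < a" "\<rho> ((1/b) *\<^sub>R x) \<le> 1"
    using cInf_lessD[OF N_set_nonempty[OF assms(1)], of a] assms(2) unfolding N_eq_Inf by blast
  have "\<rho> ((1/a) *\<^sub>R x) \<le> \<rho> ((1/b) *\<^sub>R x)"
    using b by (intro rho_mono_scale assms) (auto simp: frac_le)
  with b show ?thesis by simp
qed

lemma coord_le_N: assumes "x \<in> X" shows "\<bar>x k\<bar> \<le> N x"
proof (rule field_le_epsilon)
  fix e :: real assume e: "e > 0"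
  define a where "a = N x + e"
  have a: "a > 0" using N_nonneg[OF assms] e by (simp add: a_def)
  have "\<bar>(1/a) * x k\<bar> powr p k \<le> 1"
    using coord_le_rho[OF scale_mem[OF assms, of "1/a"], of k] rho_le_1[OF assms, of a] e
    by (simp add: a_def)
  then have "\<bar>(1/a) * x k\<bar> \<le> 1"
    using powr_one_eq_one[of "p k"] powr_less_mono2[OF p_pos[of k], of 1 "\<bar>(1/a) * x k\<bar>"] by linarith
  then have "\<bar>x k\<bar> \<le> a" using a by (simp add: abs_mult field_simps)
  then show "\<bar>x k\<bar> \<le> N x + e" by (simp add: a_def)
qed

lemma N_zero [simp]: "N 0 = 0"
proof (rule antisym)
  show "N 0 \<le> 0"
  proof (rule field_le_epsilon)
    show "N 0 \<le> 0 + e" if "e > 0" for e :: real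
      using N_le[OF subspace_0[OF subspace_X] that] by simp
  qed
  show "0 \<le> N 0" by (rule N_nonneg[OF subspace_0[OF subspace_X]])
qed

lemma N_scale_le: assumes "x \<in> X" "c \<noteq> 0" shows "N (c *\<^sub>R x) \<le> \<bar>c\<bar> * N x"
proof (rule dense_ge)
  fix b assume b: "\<bar>c\<bar> * N x < b"
  define a where "a = b / \<bar>c\<bar>"
  have a: "N x < a" using b assms by (simp add: a_def field_simps)
  have b0: "0 < b" using b N_nonneg[OF assms(1)] by (smt (verit) mult_nonneg_nonneg abs_ge_zero)
  have "\<rho> ((1/b) *\<^sub>R c *\<^sub>R x) = \<rho> ((1/a) *\<^sub>R x)"
    by (simp add: rho_def a_def abs_mult)
  also have "\<dots> \<le> 1" using rho_le_1[OF assms(1) a] .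
  finally show "N (c *\<^sub>R x) \<le> b" by (intro N_le scale_mem assms b0)
qed

lemma N_scale: assumes "x \<in> X" shows "N (c *\<^sub>R x) = \<bar>c\<bar> * N x"
proof (cases "c = 0")
  case True then show ?thesis by simp
next
  case False
  have "N x \<le> \<bar>1/c\<bar> * N (c *\<^sub>R x)"
    using N_scale_le[OF scale_mem[OF assms, of c], of "1/c"] False by simp
  then have "\<bar>c\<bar> * N x \<le> N (c *\<^sub>R x)" using False by (simp add: field_simps)
  with N_scale_le[OF assms False] show ?thesis by simp
qed

lemma N_triangle: assumes "x \<in> X" "y \<in> X" shows "N (x + y) \<le> N x + N y"
proof (rule field_le_epsilon)
  fix e :: real assume e: "e > 0"
  define a b where "a = N x + e/2" and "b = N y + e/2"
  have ab: "a > 0" "b > 0" using N_nonneg assms e by (auto simp: a_def b_def add_nonneg_pos)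
  define t where "t = b / (a + b)"
  have t: "0 \<le> t" "t \<le> 1" "1 - t = a / (a + b)"
    using ab by (auto simp: t_def field_simps)
  have "(1/(a + b)) *\<^sub>R (x + y) = (1 - t) *\<^sub>R ((1/a) *\<^sub>R x) + t *\<^sub>R ((1/b) *\<^sub>R y)"
    using ab unfolding t(3) by (simp add: t_def scaleR_add_right)
  then have "\<rho> ((1/(a + b)) *\<^sub>R (x + y)) \<le> (1 - t) * \<rho> ((1/a) *\<^sub>R x) + t * \<rho> ((1/b) *\<^sub>R y)"
    using convex_comb_mem_rho(2)[of "(1/a) *\<^sub>R x" "(1/b) *\<^sub>R y" t] assms t by (simp add: scale_mem)
  also have "\<dots> \<le> (1 - t) * 1 + t * 1"
    using rho_le_1[OF assms(1), of a] rho_le_1[OF assms(2), of b] e t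
    by (intro add_mono mult_left_mono) (auto simp: a_def b_def)
  finally have "N (x + y) \<le> a + b" using ab assms by (intro N_le) (auto simp: add_mem)
  then show "N (x + y) \<le> N x + N y + e" by (simp add: a_def b_def)
qed

lemma N_diff_commute: assumes "x \<in> X" "y \<in> X" shows "N (x - y) = N (y - x)"
  using N_scale[OF diff_mem[OF assms], of "-1"] by simp

lemma N_diff_triangle:
  assumes "x \<in> X" "y \<in> X" "z \<in> X" shows "N (x - z) \<le> N (x - y) + N (y - z)"
  using N_triangle[OF diff_mem[OF assms(1,2)] diff_mem[OF assms(2,3)]] by simp

lemma normed_on_X: "normed_on X N"
  unfolding normed_on_def
proof (intro conjI ballI allI)
  fix x assume x: "x \<in> X"
  show "N x = 0 \<longleftrightarrow> x = 0"
  proof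
    assume "N x = 0"
    then show "x = 0" using coord_le_N[OF x] by (simp add: fun_eq_iff)
  qed simp
qed (auto simp: subspace_X N_nonneg N_scale N_triangle)

lemma rho_bounded_of_N:
  assumes "x \<in> X" "N x \<le> B" shows "\<rho> x \<le> (\<bar>B\<bar> + 1) powr P"
proof -
  define a where "a = \<bar>B\<bar> + 1"
  have a: "1 \<le> a" "N x < a" using assms by (auto simp: a_def)
  have "\<rho> x = \<rho> (a *\<^sub>R ((1/a) *\<^sub>R x))" using a by simp
  also have "\<dots> \<le> a powr P * \<rho> ((1/a) *\<^sub>R x)" using a by (intro rho_stretch scale_mem assms)
  also have "\<dots> \<le> a powr P" using rho_le_1[OF assms(1) a(2)] by (simp add: mult_left_le)
  finally show ?thesis by (simp add: a_def)
qed

text \<open>The coordinatewise limit is also the norm limit, because a modular bound for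
  \<open>f m - f n\<close> survives the passage to the limit in \<open>n\<close>.\<close>

lemma complete_X:
  assumes X: "\<And>n. f n \<in> X"
    and Cauchy: "\<And>e. e > 0 \<Longrightarrow> \<exists>M. \<forall>m\<ge>M. \<forall>n\<ge>M. N (f m - f n) < e"
  shows "\<exists>x\<in>X. (\<lambda>n. N (f n - x)) \<longlonglongrightarrow> 0"
proof -
  have "\<exists>l. (\<lambda>n. f n k) \<longlonglongrightarrow> l" for k
  proof -
    have "Cauchy (\<lambda>n. f n k)"
    proof (rule metric_CauchyI)
      fix e :: real assume "e > 0"
      then obtain M where M: "\<forall>m\<ge>M. \<forall>n\<ge>M. N (f m - f n) < e" using Cauchy by blast
      have "dist (f m k) (f n k) < e" if "m \<ge> M" "n \<ge> M" for m n
        using coord_le_N[OF diff_mem[OF X X], of m n k] M that by (auto simp: dist_real_def intro: le_less_trans)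
      then show "\<exists>M. \<forall>m\<ge>M. \<forall>n\<ge>M. dist (f m k) (f n k) < e" by blast
    qed
    then show ?thesis by (simp add: Cauchy_convergent_iff convergent_def)
  qed
  then obtain x where x: "\<And>k. (\<lambda>n. f n k) \<longlonglongrightarrow> x k" by metis
  have close: "\<exists>M. \<forall>m\<ge>M. f m - x \<in> X \<and> N (f m - x) \<le> e" if e: "e > 0" for e
  proof -
    obtain M where M: "\<forall>m\<ge>M. \<forall>n\<ge>M. N (f m - f n) < e" using Cauchy e by blast
    have "f m - x \<in> X \<and> N (f m - x) \<le> e" if m: "m \<ge> M" for m
    proof -
      have lim: "(\<lambda>n. ((1/e) *\<^sub>R (f m - f n)) k) \<longlonglongrightarrow> ((1/e) *\<^sub>R (f m - x)) k" for k
        unfolding scaleR_fun_apply minus_apply by (intro tendsto_intros x)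
      have ev: "\<forall>\<^sub>F n in sequentially. \<rho> ((1/e) *\<^sub>R (f m - f n)) \<le> 1"
        using eventually_ge_at_top[of M] by eventually_elim (use M m X in \<open>auto intro!: rho_le_1 diff_mem\<close>)
      have mem: "(1/e) *\<^sub>R (f m - x) \<in> X" and le: "\<rho> ((1/e) *\<^sub>R (f m - x)) \<le> 1"
        by (rule rho_Fatou[OF _ lim ev], intro scale_mem diff_mem X)+
      have "f m - x \<in> X" using scale_mem[OF mem, of e] e by simp
      with le e show ?thesis by (auto intro: N_le)
    qed
    then show ?thesis by blast
  qed
  obtain M where "f M - x \<in> X" using close[of 1] by auto
  then have xX: "x \<in> X" using diff_mem[OF X[of M]] by fastforce
  have "(\<lambda>n. N (f n - x)) \<longlonglongrightarrow> 0"
  proof (rule LIMSEQ_I)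
    fix e :: real assume e: "e > 0"
    obtain M where "\<forall>m\<ge>M. f m - x \<in> X \<and> N (f m - x) \<le> e/2" using close[of "e/2"] e by auto
    then have "\<forall>m\<ge>M. norm (N (f m - x) - 0) < e" using e by (force simp: N_nonneg)
    then show "\<exists>M. \<forall>m\<ge>M. norm (N (f m - x) - 0) < e" by blast
  qed
  with xX show ?thesis by blast
qed

lemma banach_on_X: "banach_on X N"
proof -
  interpret Metric_space X "norm_dist X N" by (rule Metric_space_norm_dist[OF normed_on_X])
  have "\<exists>x. limitin mtopology f x sequentially" if "MCauchy f" for f
  proof -
    have X: "f n \<in> X" for n using that by (auto simp: MCauchy_def)
    have "\<exists>M. \<forall>m\<ge>M. \<forall>n\<ge>M. N (f m - f n) < e" if "e > 0" for e
      using \<open>MCauchy f\<close> that X unfolding MCauchy_def norm_dist_def by (simp; metis)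
    then obtain x where "x \<in> X" "(\<lambda>n. N (f n - x)) \<longlonglongrightarrow> 0" using complete_X[of f] X by blast
    then have "limitin mtopology f x sequentially"
      by (simp add: limitin_metric_dist_null norm_dist_def X)
    then show ?thesis by blast
  qed
  then show ?thesis by (simp add: banach_on_def normed_on_X mcomplete_def)
qed

section \<open>Sequences vanishing coordinatewise\<close>

text \<open>By \<open>vanishing_scale\<close> below, the mass \<open>r\<close> is also the limit of the norms of \<open>w n\<close>.\<close>

definition vanishing :: "(nat \<Rightarrow> nat \<Rightarrow> real) \<Rightarrow> real \<Rightarrow> bool" where
  "vanishing w r \<longleftrightarrow> (\<forall>n. w n \<in> X) \<and> (\<forall>k. (\<lambda>n. w n k) \<longlonglongrightarrow> 0) \<and> (\<lambda>n. \<rho> (w n)) \<longlonglongrightarrow> r"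

lemma vanishingD:
  assumes "vanishing w r"
  shows "w n \<in> X" "(\<lambda>n. w n k) \<longlonglongrightarrow> 0" "(\<lambda>n. \<rho> (w n)) \<longlonglongrightarrow> r"
  using assms by (auto simp: vanishing_def)

lemma vanishing_nonneg: "vanishing w r \<Longrightarrow> 0 \<le> r"
  by (rule LIMSEQ_le_const[OF vanishingD(3)]) (auto intro: rho_nonneg vanishingD(1))

lemma vanishing_bound:
  assumes "vanishing w r" obtains M where "0 < M" "\<And>n. \<rho> (w n) \<le> M"
proof -
  have "Bseq (\<lambda>n. \<rho> (w n))"
    using vanishingD(3)[OF assms] by (intro convergent_imp_Bseq) (auto simp: convergent_def)
  then obtain M where "0 < M" "\<And>n. norm (\<rho> (w n)) \<le> M" by (auto simp: Bseq_def)
  then show ?thesis using that[of M] by (auto simp: abs_le_iff)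
qed

text \<open>Finitely many coordinates contribute nothing in the limit, and on the others the weight is
  small.\<close>

lemma vanishing_weighted_sum:
  assumes w: "vanishing w r" and g: "g \<longlonglongrightarrow> 0"
  shows "(\<lambda>n. \<Sum>k. g k * \<bar>w n k\<bar> powr p k) \<longlonglongrightarrow> 0"
proof (rule LIMSEQ_I)
  fix e :: real assume e: "e > 0"
  obtain M where M: "0 < M" "\<And>n. \<rho> (w n) \<le> M" using vanishing_bound[OF w] by blast
  have d: "e / (2 * M) > 0" using e M by simp
  obtain K where K: "\<And>k. k \<ge> K \<Longrightarrow> \<bar>g k\<bar> < e / (2 * M)"
    using LIMSEQ_D[OF g d] by auto
  have W: "summable (\<lambda>k. \<bar>w n k\<bar> powr p k)" for n using vanishingD(1)[OF w] by (simp add: X_summable)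
  have tail_s: "summable (\<lambda>k. g (k + K) * \<bar>w n (k + K)\<bar> powr p (k + K))" for n
  proof (rule summable_comparison_test'[of _ 0])
    show "summable (\<lambda>k. e / (2 * M) * \<bar>w n (k + K)\<bar> powr p (k + K))"
      using W by (intro summable_mult) (simp add: summable_iff_shift[of "\<lambda>k. \<bar>w n k\<bar> powr p k"])
    show "norm (g (k + K) * \<bar>w n (k + K)\<bar> powr p (k + K)) \<le> e / (2 * M) * \<bar>w n (k + K)\<bar> powr p (k + K)" for k
      using mult_right_mono[OF less_imp_le[OF K[of "k + K"]], of "\<bar>w n (k + K)\<bar> powr p (k + K)"]
      by (simp add: abs_mult)
  qed
  have tail: "\<bar>\<Sum>k. g (k + K) * \<bar>w n (k + K)\<bar> powr p (k + K)\<bar> \<le> e/2" for n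
  proof -
    have Wt: "summable (\<lambda>k. \<bar>w n (k + K)\<bar> powr p (k + K))"
      using W by (simp add: summable_iff_shift[of "\<lambda>k. \<bar>w n k\<bar> powr p k"])
    have le: "\<bar>g (k + K) * \<bar>w n (k + K)\<bar> powr p (k + K)\<bar> \<le> e / (2 * M) * \<bar>w n (k + K)\<bar> powr p (k + K)" for k
      using mult_right_mono[OF less_imp_le[OF K[of "k + K"]], of "\<bar>w n (k + K)\<bar> powr p (k + K)"]
      by (simp add: abs_mult)
    have abs_s: "summable (\<lambda>k. \<bar>g (k + K) * \<bar>w n (k + K)\<bar> powr p (k + K)\<bar>)"
      by (rule summable_comparison_test'[OF summable_mult[OF Wt, of "e / (2*M)"], of 0]) (use le in simp)
    have "\<bar>\<Sum>k. g (k + K) * \<bar>w n (k + K)\<bar> powr p (k + K)\<bar> \<le> (\<Sum>k. \<bar>g (k + K) * \<bar>w n (k + K)\<bar> powr p (k + K)\<bar>)"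
      by (rule summable_rabs[OF abs_s])
    also have "\<dots> \<le> (\<Sum>k. e / (2 * M) * \<bar>w n (k + K)\<bar> powr p (k + K))"
      by (rule suminf_le[OF le abs_s summable_mult[OF Wt]])
    also have "\<dots> = e / (2 * M) * (\<Sum>k. \<bar>w n (k + K)\<bar> powr p (k + K))"
      by (rule suminf_mult[OF Wt])
    also have "\<dots> \<le> e / (2 * M) * \<rho> (w n)"
      using suminf_split_initial_segment[OF W[of n], of K] d sum_nonneg[of "{..<K}" "\<lambda>k. \<bar>w n k\<bar> powr p k"]
      by (intro mult_left_mono) (auto simp: rho_def)
    also have "\<dots> \<le> e / (2 * M) * M" using d M by (intro mult_left_mono) auto
    finally show ?thesis using M by simp
  qed
  have "(\<lambda>n. \<Sum>k<K. g k * \<bar>w n k\<bar> powr p k) \<longlonglongrightarrow> (\<Sum>k<K. g k * \<bar>0\<bar> powr p k)"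
    by (intro tendsto_sum tendsto_mult tendsto_powr2 tendsto_rabs vanishingD(2)[OF w] tendsto_const) (use p_pos in auto)
  then have "(\<lambda>n. \<Sum>k<K. g k * \<bar>w n k\<bar> powr p k) \<longlonglongrightarrow> 0" by simp
  from LIMSEQ_D[OF this, of "e/2"] e obtain n0 where
    n0: "\<And>n. n \<ge> n0 \<Longrightarrow> \<bar>\<Sum>k<K. g k * \<bar>w n k\<bar> powr p k\<bar> < e/2" by auto
  have "norm ((\<Sum>k. g k * \<bar>w n k\<bar> powr p k) - 0) < e" if "n \<ge> n0" for n
  proof -
    have "summable (\<lambda>k. g k * \<bar>w n k\<bar> powr p k)"
      using tail_s[of n] summable_iff_shift[of "\<lambda>k. g k * \<bar>w n k\<bar> powr p k" K] by simp
    from suminf_split_initial_segment[OF this, of K] show ?thesis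
      using n0[OF that] tail[of n] by simp
  qed
  then show "\<exists>n0. \<forall>n\<ge>n0. norm ((\<Sum>k. g k * \<bar>w n k\<bar> powr p k) - 0) < e" by blast
qed

text \<open>The modular is asymptotically homogeneous of degree 1: scaling by \<open>c\<close> multiplies the
  coordinate \<open>k\<close> of the modular by \<open>c powr p k\<close>, and \<open>c powr p k - c\<close> tends to 0.\<close>

lemma vanishing_scale:
  assumes w: "vanishing w r" and c: "0 < c"
  shows "vanishing (\<lambda>n. c *\<^sub>R w n) (c * r)"
  unfolding vanishing_def
proof (intro conjI allI)
  show "c *\<^sub>R w n \<in> X" for n by (rule scale_mem[OF vanishingD(1)[OF w]])
  show "(\<lambda>n. (c *\<^sub>R w n) k) \<longlonglongrightarrow> 0" for k
    using tendsto_mult_right_zero[OF vanishingD(2)[OF w], of c k] by simp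
  have "(\<lambda>k. c powr p k - c) \<longlonglongrightarrow> c powr 1 - c"
    using c by (intro tendsto_intros p_lim) auto
  then have g: "(\<lambda>k. c powr p k - c) \<longlonglongrightarrow> 0" using c by simp
  have eq: "\<rho> (c *\<^sub>R w n) = (\<Sum>k. (c powr p k - c) * \<bar>w n k\<bar> powr p k) + c * \<rho> (w n)" for n
  proof -
    have s: "summable (\<lambda>k. c * \<bar>w n k\<bar> powr p k)" "summable (\<lambda>k. c powr p k * \<bar>w n k\<bar> powr p k)"
      using vanishingD(1)[OF w, of n] scale_mem[OF vanishingD(1)[OF w, of n], of c] c
      by (auto simp: X_summable abs_mult powr_mult intro: summable_mult)
    have "\<rho> (c *\<^sub>R w n) - c * \<rho> (w n) = (\<Sum>k. c powr p k * \<bar>w n k\<bar> powr p k - c * \<bar>w n k\<bar> powr p k)"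
      using suminf_diff[OF s(2,1)] c vanishingD(1)[OF w, of n]
      by (simp add: rho_def X_summable abs_mult powr_mult suminf_mult)
    then show ?thesis by (simp add: left_diff_distrib)
  qed
  show "(\<lambda>n. \<rho> (c *\<^sub>R w n)) \<longlonglongrightarrow> c * r"
    unfolding eq using tendsto_add[OF vanishing_weighted_sum[OF w g] tendsto_mult_left[OF vanishingD(3)[OF w], of c]]
    by simp
qed

text \<open>A convex combination in which the perturbation carries the small weight \<open>l\<close>:
  \<open>a + b = (1 - l) a + l (a + b/l)\<close>.\<close>

lemma rho_add_small_step:
  assumes "a \<in> X" "b \<in> X" "0 < l" "l \<le> 1"
  shows "\<rho> (a + b) \<le> \<rho> a + l * (2 powr P * (\<rho> a + (1/l) powr P * \<rho> b))"
proof -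
  have "a + b = (1 - l) *\<^sub>R a + l *\<^sub>R (a + (1/l) *\<^sub>R b)"
    using assms by (simp add: scaleR_add_right scaleR_left_diff_distrib)
  then have "\<rho> (a + b) \<le> (1 - l) * \<rho> a + l * \<rho> (a + (1/l) *\<^sub>R b)"
    using convex_comb_mem_rho(2)[of a "a + (1/l) *\<^sub>R b" l] assms by (simp add: add_mem scale_mem)
  also have "\<dots> \<le> \<rho> a + l * \<rho> (a + (1/l) *\<^sub>R b)"
    using mult_nonneg_nonneg[of l "\<rho> a"] assms rho_nonneg[of a] by (simp add: left_diff_distrib)
  also have "\<rho> (a + (1/l) *\<^sub>R b) \<le> 2 powr P * (\<rho> a + \<rho> ((1/l) *\<^sub>R b))"
    using assms by (intro rho_add_le scale_mem)
  also have "\<rho> ((1/l) *\<^sub>R b) \<le> (1/l) powr P * \<rho> b"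
    using assms by (intro rho_stretch) auto
  finally show ?thesis using assms by (simp add: mult_left_mono)
qed

text \<open>In \<open>rho_add_small_step\<close>, fix \<open>l\<close> so small that the error is harmless as long as
  \<open>\<rho> (b/l) \<le> 1\<close>, which \<open>\<rho> b \<le> l powr P\<close> guarantees. The other inequality is the same one for
  the vectors \<open>a + b\<close> and \<open>- b\<close>.\<close>

lemma rho_uniformly_continuous:
  assumes M: "0 \<le> M" and e: "0 < e"
  shows "\<exists>d>0. \<forall>a\<in>X. \<forall>b\<in>X. \<rho> a \<le> M \<longrightarrow> \<rho> b \<le> d \<longrightarrow> \<bar>\<rho> (a + b) - \<rho> a\<bar> \<le> e"
proof -
  define l where "l = min 1 (min e 1 / (2 powr P * (M + 2)))"
  have l: "0 < l" "l \<le> 1" using M e by (auto simp: l_def)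
  have "l * (2 powr P * (M + 2)) \<le> min e 1 / (2 powr P * (M + 2)) * (2 powr P * (M + 2))"
    using M by (intro mult_right_mono) (auto simp: l_def)
  also have "\<dots> = min e 1" using M by (simp add: add_eq_0_iff)
  finally have le: "l * (2 powr P * (M + 2)) \<le> min e 1" .
  have key: "\<rho> (a + b) \<le> \<rho> a + min e 1"
    if "a \<in> X" "b \<in> X" "\<rho> a \<le> M + 1" "\<rho> b \<le> l powr P" for a b
  proof -
    have "(1/l) powr P * \<rho> b \<le> (1/l) powr P * l powr P"
      using that by (intro mult_left_mono) auto
    also have "\<dots> = 1" using l by (simp add: powr_divide)
    finally have "l * (2 powr P * (\<rho> a + (1/l) powr P * \<rho> b)) \<le> l * (2 powr P * (M + 2))"
      using that l by (intro mult_left_mono) auto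
    then show ?thesis using rho_add_small_step[OF that(1,2) l] le by linarith
  qed
  have "\<bar>\<rho> (a + b) - \<rho> a\<bar> \<le> e" if ab: "a \<in> X" "b \<in> X" "\<rho> a \<le> M" "\<rho> b \<le> l powr P" for a b
  proof -
    have 1: "\<rho> (a + b) \<le> \<rho> a + min e 1" using ab by (intro key) auto
    have "\<rho> ((a + b) + - b) \<le> \<rho> (a + b) + min e 1"
      using ab 1 by (intro key) (auto simp: rho_minus add_mem neg_mem)
    with 1 show ?thesis by simp
  qed
  with l show ?thesis by (intro exI[of _ "l powr P"]) auto
qed

lemma truncation:
  assumes v: "v \<in> X" and e: "0 < e"
  obtains K u where "\<And>k. k \<ge> K \<Longrightarrow> u k = 0" "u \<in> X" "\<rho> u \<le> \<rho> v" "\<rho> (v - u) < e"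
proof -
  have s: "summable (\<lambda>k. \<bar>v k\<bar> powr p k)" using v by (simp add: X_summable)
  obtain K where K: "norm (\<Sum>k. \<bar>v (k + K)\<bar> powr p (k + K)) < e"
    using suminf_exist_split[OF e s] by blast
  define u where "u = (\<lambda>k. if k < K then v k else 0)"
  have le: "\<bar>u k\<bar> powr p k \<le> \<bar>v k\<bar> powr p k" for k by (simp add: u_def)
  have us: "summable (\<lambda>k. \<bar>u k\<bar> powr p k)"
    by (rule summable_comparison_test'[OF s, of 0]) (use le in simp)
  have u: "u \<in> X" using us by (simp add: X_summable)
  have "\<rho> (v - u) = (\<Sum>k. \<bar>(v - u) (k + K)\<bar> powr p (k + K)) + (\<Sum>k<K. \<bar>(v - u) k\<bar> powr p k)"
    unfolding rho_def using diff_mem[OF v u] by (intro suminf_split_initial_segment) (simp add: X_summable)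
  also have "\<dots> = (\<Sum>k. \<bar>v (k + K)\<bar> powr p (k + K))" by (simp add: u_def)
  also have "\<dots> < e" using K by auto
  finally have "\<rho> (v - u) < e" .
  moreover have "\<rho> u \<le> \<rho> v" unfolding rho_def by (rule suminf_le[OF le us s])
  ultimately show ?thesis using u by (intro that[of K u]) (auto simp: u_def)
qed

lemma rho_add_finite_support:
  assumes w: "vanishing w r" and u: "u \<in> X" and K: "\<And>k. k \<ge> K \<Longrightarrow> u k = 0"
  shows "(\<lambda>n. \<rho> (w n + u)) \<longlonglongrightarrow> r + \<rho> u"
proof -
  have eq: "\<rho> (w n + u) = \<rho> (w n) + (\<Sum>k<K. \<bar>w n k + u k\<bar> powr p k - \<bar>w n k\<bar> powr p k)" for n
  proof -
    have s: "summable (\<lambda>k. \<bar>w n k + u k\<bar> powr p k)" "summable (\<lambda>k. \<bar>w n k\<bar> powr p k)"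
      using add_mem[OF vanishingD(1)[OF w, of n] u] vanishingD(1)[OF w, of n] by (auto simp: X_summable)
    have "\<rho> (w n + u) - \<rho> (w n) = (\<Sum>k. \<bar>w n k + u k\<bar> powr p k - \<bar>w n k\<bar> powr p k)"
      using suminf_diff[OF s] by (simp add: rho_def)
    also have "\<dots> = (\<Sum>k<K. \<bar>w n k + u k\<bar> powr p k - \<bar>w n k\<bar> powr p k)"
      by (rule suminf_finite) (auto simp: K)
    finally show ?thesis by simp
  qed
  have "(\<lambda>n. \<Sum>k<K. \<bar>w n k + u k\<bar> powr p k - \<bar>w n k\<bar> powr p k) \<longlonglongrightarrow> (\<Sum>k<K. \<bar>0 + u k\<bar> powr p k - \<bar>0\<bar> powr p k)"
    by (intro tendsto_sum tendsto_diff tendsto_add tendsto_powr2 tendsto_rabs vanishingD(2)[OF w] tendsto_const)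
       (use p_pos in auto)
  moreover have "(\<Sum>k<K. \<bar>0 + u k\<bar> powr p k - \<bar>0\<bar> powr p k) = \<rho> u"
    unfolding rho_def by (subst suminf_finite[of "{..<K}"]) (auto simp: K)
  ultimately show ?thesis unfolding eq by (intro tendsto_add vanishingD(3)[OF w]) simp
qed

text \<open>A Brezis-Lieb property. For finitely supported \<open>v\<close> only finitely many coordinates of the
  modular change; the general case follows by truncating \<open>v\<close>, since \<open>\<rho>\<close> is uniformly continuous
  on modular-bounded sets.\<close>

lemma rho_add_vanishing:
  assumes w: "vanishing w r" and v: "v \<in> X"
  shows "(\<lambda>n. \<rho> (w n + v)) \<longlonglongrightarrow> r + \<rho> v"
proof (rule LIMSEQ_I)
  fix e :: real assume e: "e > 0"
  obtain M0 where M0: "0 < M0" "\<And>n. \<rho> (w n) \<le> M0" using vanishing_bound[OF w] by blast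
  define M where "M = 2 powr P * (M0 + \<rho> v)"
  have "1 \<le> 2 powr P" using P_gt1 by (simp add: ge_one_powr_ge_zero)
  then have "1 * \<rho> v \<le> M"
    unfolding M_def using rho_nonneg[OF v] M0 by (intro mult_mono) auto
  then have M: "\<rho> v \<le> M" "0 \<le> M" using rho_nonneg[OF v] by auto
  obtain d where d: "d > 0" "\<forall>a\<in>X. \<forall>b\<in>X. \<rho> a \<le> M \<longrightarrow> \<rho> b \<le> d \<longrightarrow> \<bar>\<rho> (a + b) - \<rho> a\<bar> \<le> e/4"
    using rho_uniformly_continuous[OF M(2), of "e/4"] e by auto
  obtain K u where u: "\<And>k. k \<ge> K \<Longrightarrow> u k = 0" "u \<in> X" "\<rho> u \<le> \<rho> v" "\<rho> (v - u) < d"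
    using truncation[OF v d(1)] by blast
  have 1: "\<bar>\<rho> (w n + v) - \<rho> (w n + u)\<bar> \<le> e/4" for n
  proof -
    have "\<rho> (w n + u) \<le> 2 powr P * (\<rho> (w n) + \<rho> u)" by (rule rho_add_le[OF vanishingD(1)[OF w] u(2)])
    also have "\<dots> \<le> M" unfolding M_def using M0(2)[of n] u by (intro mult_left_mono add_mono) auto
    finally show ?thesis
      using d(2)[rule_format, of "w n + u" "v - u"] u v vanishingD(1)[OF w, of n]
      by (simp add: add_mem diff_mem)
  qed
  have 2: "\<bar>\<rho> v - \<rho> u\<bar> \<le> e/4"
    using d(2)[rule_format, of u "v - u"] u v M by (simp add: diff_mem)
  have "(\<lambda>n. \<rho> (w n + u)) \<longlonglongrightarrow> r + \<rho> u"
    by (rule rho_add_finite_support[OF w u(2), of K]) (rule u(1))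
  from LIMSEQ_D[OF this, of "e/4"] e
  obtain n0 where n0: "\<And>n. n \<ge> n0 \<Longrightarrow> \<bar>\<rho> (w n + u) - (r + \<rho> u)\<bar> < e/4" by auto
  have "norm (\<rho> (w n + v) - (r + \<rho> v)) < e" if "n \<ge> n0" for n
    using 1[of n] 2 n0[OF that] e unfolding real_norm_def by linarith
  then show "\<exists>n0. \<forall>n\<ge>n0. norm (\<rho> (w n + v) - (r + \<rho> v)) < e" by blast
qed

lemma rho_scaled_add_vanishing:
  assumes w: "vanishing w r" and v: "v \<in> X" and c: "0 < c"
  shows "(\<lambda>n. \<rho> (c *\<^sub>R (w n + v))) \<longlonglongrightarrow> c * r + \<rho> (c *\<^sub>R v)"
  using rho_add_vanishing[OF vanishing_scale[OF w c] scale_mem[OF v, of c]]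
  by (simp add: scaleR_add_right)

text \<open>Here all exponents being greater than 1 matters: coordinate \<open>k\<close> of \<open>\<rho> (t v)/t\<close> carries the
  factor \<open>t powr (p k - 1)\<close>, which tends to 0 with \<open>t\<close>, and dominated convergence applies.\<close>

lemma rho_sublinear_at_0:
  assumes v: "v \<in> X" and e: "0 < e"
  shows "\<exists>t. 0 < t \<and> t < 1 \<and> \<rho> (t *\<^sub>R v) \<le> e * t"
proof -
  define t where "t = (\<lambda>n. 1 / real (n + 2))"
  have t: "0 < t n" "t n < 1" for n by (auto simp: t_def)
  have t0: "t \<longlonglongrightarrow> 0" unfolding t_def by (rule LIMSEQ_ignore_initial_segment[OF lim_1_over_n])
  have s: "summable (\<lambda>k. \<bar>v k\<bar> powr p k)" using v by (simp add: X_summable)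
  have lim: "(\<lambda>n. t n powr (p k - 1) * \<bar>v k\<bar> powr p k) \<longlonglongrightarrow> 0" for k
  proof -
    have "(\<lambda>n. t n powr (p k - 1)) \<longlonglongrightarrow> 0 powr (p k - 1)"
      by (rule tendsto_powr2[OF t0 tendsto_const]) (use t(1) p_gt1[of k] in \<open>auto intro!: always_eventually less_imp_le\<close>)
    then show ?thesis by (intro tendsto_mult_left_zero) simp
  qed
  have small: "t n powr (p k - 1) \<le> 1" for n k
    using t[of n] p_gt1[of k] by (intro powr_le1) auto
  have bd: "\<forall>\<^sub>F (k,n) in sequentially \<times>\<^sub>F sequentially. norm (t n powr (p k - 1) * \<bar>v k\<bar> powr p k) \<le> \<bar>v k\<bar> powr p k"
    using small by (auto intro!: always_eventually mult_left_le_one_le)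
  have "(\<lambda>n. \<Sum>k. t n powr (p k - 1) * \<bar>v k\<bar> powr p k) \<longlonglongrightarrow> (\<Sum>k. 0)"
    using tannerys_theorem[OF lim bd s] by simp
  then have "(\<lambda>n. \<Sum>k. t n powr (p k - 1) * \<bar>v k\<bar> powr p k) \<longlonglongrightarrow> 0" by simp
  from order_tendstoD(2)[OF this e] obtain n where n: "(\<Sum>k. t n powr (p k - 1) * \<bar>v k\<bar> powr p k) < e"
    by (auto simp: eventually_sequentially)
  have summand: "\<bar>(t n *\<^sub>R v) k\<bar> powr p k = t n * (t n powr (p k - 1) * \<bar>v k\<bar> powr p k)" for k
    using t(1)[of n] by (simp add: abs_mult powr_mult powr_diff)
  have "summable (\<lambda>k. t n powr (p k - 1) * \<bar>v k\<bar> powr p k)"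
    by (rule summable_comparison_test'[OF s, of 0]) (use small in \<open>auto intro: mult_left_le_one_le\<close>)
  then have "\<rho> (t n *\<^sub>R v) = t n * (\<Sum>k. t n powr (p k - 1) * \<bar>v k\<bar> powr p k)"
    unfolding rho_def summand by (rule suminf_mult)
  also have "\<dots> \<le> t n * e" using n t(1)[of n] by (intro mult_left_mono) auto
  finally show ?thesis using t[of n] by (intro exI[of _ "t n"]) (simp add: mult.commute)
qed

section \<open>Invariant sets and approximate fixed points\<close>

definition inv_set :: "((nat \<Rightarrow> real) \<Rightarrow> nat \<Rightarrow> real) \<Rightarrow> (nat \<Rightarrow> real) set \<Rightarrow> bool" where
  "inv_set T D \<longleftrightarrow> D \<noteq> {} \<and> D \<subseteq> X \<and> convex D \<and> T ` D \<subseteq> D \<and>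
     (\<forall>x\<in>D. \<forall>y\<in>D. N (T x - T y) \<le> N (x - y)) \<and> (\<exists>B. \<forall>x\<in>D. \<forall>y\<in>D. N (x - y) \<le> B)"

lemma inv_setD:
  assumes "inv_set T D"
  shows "D \<noteq> {}" "x \<in> D \<Longrightarrow> x \<in> X" "convex D" "x \<in> D \<Longrightarrow> T x \<in> D"
    "x \<in> D \<Longrightarrow> y \<in> D \<Longrightarrow> N (T x - T y) \<le> N (x - y)"
  using assms unfolding inv_set_def by blast+

lemma inv_set_comb:
  assumes "inv_set T D" "x \<in> D" "y \<in> D" "0 \<le> t" "t \<le> 1"
  shows "(1 - t) *\<^sub>R x + t *\<^sub>R y \<in> D"
  using inv_setD(3)[OF assms(1)] assms(2-) by (auto simp: convex_alt)

lemma inv_set_diam: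
  assumes "inv_set T D"
  obtains B where "0 \<le> B" "\<And>x y. x \<in> D \<Longrightarrow> y \<in> D \<Longrightarrow> N (x - y) \<le> B"
proof -
  obtain B where B: "\<forall>x\<in>D. \<forall>y\<in>D. N (x - y) \<le> B" using assms unfolding inv_set_def by blast
  obtain x where "x \<in> D" using inv_setD(1)[OF assms] by blast
  then have "0 \<le> B" using B by fastforce
  with B show ?thesis using that by blast
qed

text \<open>Pull \<open>T\<close> towards a point \<open>u\<close> of the set: \<open>y \<mapsto> (1 - l) T y + l u\<close> is a strict contraction, so
  its iterates move less and less, and it differs from \<open>T\<close> by at most \<open>l\<close> times the diameter.\<close>

lemma approx_fixed_point:
  assumes D: "inv_set T D" and e: "0 < e"
  shows "\<exists>y\<in>D. N (y - T y) \<le> e"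
proof -
  obtain B where B: "0 \<le> B" "\<And>x y. x \<in> D \<Longrightarrow> y \<in> D \<Longrightarrow> N (x - y) \<le> B" using inv_set_diam[OF D] by blast
  obtain u where u: "u \<in> D" using inv_setD(1)[OF D] by blast
  define l where "l = min (1/2) (e / (2 * (B + 1)))"
  have l: "0 < l" "l < 1" using e B by (auto simp: l_def)
  have "l * B \<le> e / (2 * (B + 1)) * (B + 1)"
    using B e by (intro mult_mono) (auto simp: l_def)
  also have "\<dots> = e/2" using B by (simp add: field_simps)
  finally have lB: "l * B \<le> e/2" .
  define S where "S y = (1 - l) *\<^sub>R T y + l *\<^sub>R u" for y
  have S: "S y \<in> D" if "y \<in> D" for y
    unfolding S_def using l by (intro inv_set_comb[OF D] inv_setD(4)[OF D] that u) auto
  have contr: "N (S y - S y') \<le> (1 - l) * N (y - y')" if "y \<in> D" "y' \<in> D" for y y'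
  proof -
    have "S y - S y' = (1 - l) *\<^sub>R (T y - T y')" by (simp add: S_def scaleR_diff_right)
    then have "N (S y - S y') = (1 - l) * N (T y - T y')"
      using N_scale[OF diff_mem[OF inv_setD(2)[OF D inv_setD(4)[OF D that(1)]] inv_setD(2)[OF D inv_setD(4)[OF D that(2)]]], of "1 - l"] l
      by simp
    also have "\<dots> \<le> (1 - l) * N (y - y')" using l inv_setD(5)[OF D that] by (intro mult_left_mono) auto
    finally show ?thesis .
  qed
  define f where "f n = (S ^^ n) u" for n
  have f_0: "f 0 = u" and f_Suc: "f (Suc n) = S (f n)" for n by (simp_all add: f_def)
  have it: "f n \<in> D" for n by (induction n) (use u S in \<open>auto simp: f_0 f_Suc\<close>)
  have step: "N (f n - f (Suc n)) \<le> (1 - l) ^ n * B" for n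
  proof (induction n)
    case 0
    show ?case using B(2)[OF it it, of 0 "Suc 0"] by (simp only: power_0 mult_1)
  next
    case (Suc n)
    have "N (f (Suc n) - f (Suc (Suc n))) \<le> (1 - l) * N (f n - f (Suc n))"
      using contr[OF it[of n] it[of "Suc n"]] by (simp only: f_Suc)
    also have "\<dots> \<le> (1 - l) * ((1 - l) ^ n * B)" by (rule mult_left_mono[OF Suc.IH]) (use l in simp)
    finally show ?case by (simp only: power_Suc mult.assoc)
  qed
  have "(\<lambda>n. (1 - l) ^ n * B) \<longlonglongrightarrow> 0"
    using l by (intro tendsto_mult_left_zero LIMSEQ_realpow_zero) auto
  from order_tendstoD(2)[OF this, of "e/2"] e obtain n where n: "(1 - l) ^ n * B < e/2"
    by (auto simp: eventually_sequentially)
  define y where "y = f n"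
  have y: "y \<in> D" "N (y - S y) < e/2" using it[of n] step[of n] n by (simp_all add: y_def f_Suc)
  have mem: "y - S y \<in> X" "u - T y \<in> X"
    using inv_setD(2)[OF D] y(1) S u inv_setD(4)[OF D] by (auto intro!: diff_mem)
  have "y - T y = (y - S y) + l *\<^sub>R (u - T y)"
    by (simp add: S_def scaleR_diff_right scaleR_left_diff_distrib)
  moreover have "N ((y - S y) + l *\<^sub>R (u - T y)) \<le> N (y - S y) + l * N (u - T y)"
    using N_triangle[OF mem(1) scale_mem[OF mem(2), of l]] N_scale[OF mem(2), of l] l by simp
  ultimately have "N (y - T y) \<le> N (y - S y) + l * N (u - T y)" by (simp only:)
  also have "l * N (u - T y) \<le> l * B" using l B(2)[OF u inv_setD(4)[OF D y(1)]] by (intro mult_left_mono) auto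
  finally show ?thesis by (intro bexI[of _ y]) (use y lB in linarith)+
qed

text \<open>Approximate fixed point sequences \<open>z\<close> that converge coordinatewise to \<open>x\<close> and whose distance
  to \<open>x\<close> tends to \<open>r\<close>. The limit \<open>x\<close> need not lie in \<open>D\<close>.\<close>

definition afps where
  "afps T D z x r \<longleftrightarrow> (\<forall>n. z n \<in> D) \<and> (\<lambda>n. N (z n - T (z n))) \<longlonglongrightarrow> 0 \<and> x \<in> X \<and> vanishing (\<lambda>n. z n - x) r"

lemma afpsD:
  assumes "afps T D z x r"
  shows "z n \<in> D" "(\<lambda>n. N (z n - T (z n))) \<longlonglongrightarrow> 0" "x \<in> X" "vanishing (\<lambda>n. z n - x) r"
  using assms by (auto simp: afps_def)

lemma afps_mono: "afps T D z x r \<Longrightarrow> D \<subseteq> C \<Longrightarrow> afps T C z x r"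
  by (auto simp: afps_def)

text \<open>A diagonal subsequence converges in every coordinate; the limit is in the space by
  \<open>rho_Fatou\<close>, and a further subsequence makes the modulars of the differences converge.\<close>

lemma bounded_coordwise_subseq:
  assumes z: "\<And>n. z n \<in> X" and B: "\<And>n. N (z n) \<le> B"
  shows "\<exists>s x r. strict_mono (s :: nat \<Rightarrow> nat) \<and> x \<in> X \<and> vanishing (\<lambda>n. z (s n) - x) r"
proof -
  have "norm (z n k) \<le> B" for n k using coord_le_N[OF z[of n], of k] B[of n] by simp
  then obtain s1 :: "nat \<Rightarrow> nat" where s1: "strict_mono s1" "\<And>k. \<exists>l. (\<lambda>n. z (s1 n) k) \<longlonglongrightarrow> l"
    using function_convergent_subsequence[of UNIV z B] by (metis UNIV_I countableI_type)
  then obtain x where x: "\<And>k. (\<lambda>n. z (s1 n) k) \<longlonglongrightarrow> x k" by metis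
  have xX: "x \<in> X"
    by (rule rho_Fatou(1)[OF z x always_eventually]) (use rho_bounded_of_N[OF z B] in blast)
  have "\<bar>\<rho> (z n - x)\<bar> \<le> (\<bar>B + N (- x)\<bar> + 1) powr P" for n
    using rho_bounded_of_N[OF diff_mem[OF z xX], of n "B + N (- x)"] rho_nonneg[OF diff_mem[OF z xX], of n]
      N_triangle[OF z[of n] neg_mem[OF xX]] B[of n] by simp
  then have "bounded (range (\<lambda>n. \<rho> (z (s1 n) - x)))"
    by (auto intro!: boundedI)
  then obtain s2 r where s2: "strict_mono (s2 :: nat \<Rightarrow> nat)" "((\<lambda>n. \<rho> (z (s1 n) - x)) \<circ> s2) \<longlonglongrightarrow> r"
    using bounded_imp_convergent_subsequence by blast
  have "(\<lambda>n. (z (s1 (s2 n)) - x) k) \<longlonglongrightarrow> 0" for k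
    using LIM_zero[OF LIMSEQ_subseq_LIMSEQ[OF x[of k] s2(1)]] by (simp add: o_def)
  then have "vanishing (\<lambda>n. z ((s1 \<circ> s2) n) - x) r"
    using s2(2) z xX by (simp add: vanishing_def o_def diff_mem)
  with strict_mono_o[OF s1(1) s2(1)] xX show ?thesis by blast
qed

lemma afps_exists:
  assumes D: "inv_set T D"
  shows "\<exists>z x r. afps T D z x r"
proof -
  have "\<forall>n. \<exists>y\<in>D. N (y - T y) \<le> 1 / real (Suc n)" using approx_fixed_point[OF D] by simp
  then obtain z where z: "\<And>n. z n \<in> D" "\<And>n. N (z n - T (z n)) \<le> 1 / real (Suc n)" by metis
  have zX: "z n \<in> X" for n using inv_setD(2)[OF D z(1)] .
  have lim: "(\<lambda>n. N (z n - T (z n))) \<longlonglongrightarrow> 0"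
  proof (rule tendsto_sandwich[OF _ _ tendsto_const LIMSEQ_Suc[OF lim_1_over_n]])
    show "\<forall>\<^sub>F n in sequentially. 0 \<le> N (z n - T (z n))"
      using inv_setD(2,4)[OF D] z(1) by (auto intro!: always_eventually N_nonneg diff_mem)
    show "\<forall>\<^sub>F n in sequentially. N (z n - T (z n)) \<le> 1 / real (Suc n)" using z(2) by simp
  qed
  obtain B where "0 \<le> B" and B: "\<And>x y. x \<in> D \<Longrightarrow> y \<in> D \<Longrightarrow> N (x - y) \<le> B" using inv_set_diam[OF D] by blast
  have "N (z n) \<le> B + N (z 0)" for n
    using N_triangle[OF diff_mem[OF zX[of n] zX[of 0]] zX[of 0]] B[OF z(1) z(1), of n 0] by simp
  then obtain s x r where s: "strict_mono (s :: nat \<Rightarrow> nat)" "x \<in> X" "vanishing (\<lambda>n. z (s n) - x) r"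
    using bounded_coordwise_subseq[of z "B + N (z 0)"] zX by blast
  have "afps T D (\<lambda>n. z (s n)) x r"
    using z(1) s LIMSEQ_subseq_LIMSEQ[OF lim s(1)] by (simp add: afps_def o_def)
  then show ?thesis by blast
qed

text \<open>The points \<open>y\<close> of \<open>D\<close> with \<open>limsup \<parallel>z n - y\<parallel> \<le> s\<close>, an asymptotic ball around \<open>z\<close>.\<close>

definition lim_ball :: "(nat \<Rightarrow> nat \<Rightarrow> real) \<Rightarrow> (nat \<Rightarrow> real) set \<Rightarrow> real \<Rightarrow> (nat \<Rightarrow> real) set" where
  "lim_ball z D s = {y \<in> D. \<forall>s'>s. \<forall>\<^sub>F n in sequentially. N (z n - y) < s'}"

lemma lim_ball_subset: "lim_ball z D s \<subseteq> D"
  by (auto simp: lim_ball_def)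

text \<open>Invariance holds because \<open>\<parallel>z n - T y\<parallel>\<close> exceeds \<open>\<parallel>T (z n) - T y\<parallel> \<le> \<parallel>z n - y\<parallel>\<close> by at most
  \<open>\<parallel>z n - T (z n)\<parallel>\<close>, which tends to 0.\<close>

lemma lim_ball_inv_set:
  assumes D: "inv_set T D" and z: "\<And>n. z n \<in> D" and lim: "(\<lambda>n. N (z n - T (z n))) \<longlonglongrightarrow> 0"
    and ne: "lim_ball z D s \<noteq> {}"
  shows "inv_set T (lim_ball z D s)"
proof -
  note X = inv_setD(2)[OF D]
  have conv: "convex (lim_ball z D s)"
    unfolding convex_alt
  proof (intro ballI allI impI)
    fix x y t assume x: "x \<in> lim_ball z D s" and y: "y \<in> lim_ball z D s" and t: "0 \<le> t \<and> t \<le> (1::real)"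
    then have xy: "x \<in> D" "y \<in> D" by (auto simp: lim_ball_def)
    show "(1 - t) *\<^sub>R x + t *\<^sub>R y \<in> lim_ball z D s"
      unfolding lim_ball_def
    proof (intro CollectI conjI allI impI)
      show "(1 - t) *\<^sub>R x + t *\<^sub>R y \<in> D" using t by (intro inv_set_comb[OF D] xy) auto
      fix s' assume s': "s < s'"
      have "\<forall>\<^sub>F n in sequentially. N (z n - x) < s'" "\<forall>\<^sub>F n in sequentially. N (z n - y) < s'"
        using x y s' by (auto simp: lim_ball_def)
      then show "\<forall>\<^sub>F n in sequentially. N (z n - ((1 - t) *\<^sub>R x + t *\<^sub>R y)) < s'"
      proof eventually_elim
        case (elim n)
        have mem: "z n - x \<in> X" "z n - y \<in> X" using X z xy by (auto intro: diff_mem)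
        have "z n - ((1 - t) *\<^sub>R x + t *\<^sub>R y) = (1 - t) *\<^sub>R (z n - x) + t *\<^sub>R (z n - y)"
          by (simp add: scaleR_diff_right scaleR_left_diff_distrib)
        then have "N (z n - ((1 - t) *\<^sub>R x + t *\<^sub>R y)) \<le> (1 - t) * N (z n - x) + t * N (z n - y)"
          using N_triangle[OF scale_mem[OF mem(1), of "1 - t"] scale_mem[OF mem(2), of t]] t
          by (simp add: N_scale mem)
        also have "\<dots> < s'" using elim t by (intro convex_bound_lt) auto
        finally show ?case .
      qed
    qed
  qed
  have "T y \<in> lim_ball z D s" if y: "y \<in> lim_ball z D s" for y
    unfolding lim_ball_def
  proof (intro CollectI conjI allI impI)
    have yD: "y \<in> D" using y by (simp add: lim_ball_def)
    then show "T y \<in> D" by (rule inv_setD(4)[OF D])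
    fix s' assume s': "s < s'"
    define d where "d = (s' - s) / 2"
    have d: "d > 0" "s < s + d" using s' by (auto simp: d_def)
    have "\<forall>\<^sub>F n in sequentially. N (z n - y) < s + d" using y d by (simp add: lim_ball_def)
    moreover have "\<forall>\<^sub>F n in sequentially. N (z n - T (z n)) < d" using order_tendstoD(2)[OF lim d(1)] .
    ultimately show "\<forall>\<^sub>F n in sequentially. N (z n - T y) < s'"
    proof eventually_elim
      case (elim n)
      have "N (z n - T y) \<le> N (z n - T (z n)) + N (T (z n) - T y)"
        using X z yD inv_setD(4)[OF D] by (intro N_diff_triangle) auto
      also have "\<dots> \<le> N (z n - T (z n)) + N (z n - y)" using inv_setD(5)[OF D z yD] by simp
      also have "\<dots> < d + (s + d)" using elim by linarith
      also have "\<dots> = s'" by (simp add: d_def field_simps)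
      finally show ?case .
    qed
  qed
  then have inv: "T ` lim_ball z D s \<subseteq> lim_ball z D s" by blast
  obtain B where "0 \<le> B" and B: "\<And>x y. x \<in> D \<Longrightarrow> y \<in> D \<Longrightarrow> N (x - y) \<le> B" using inv_set_diam[OF D] by blast
  have sub: "y \<in> D" if "y \<in> lim_ball z D s" for y using that lim_ball_subset by blast
  have "\<exists>B. \<forall>x\<in>lim_ball z D s. \<forall>y\<in>lim_ball z D s. N (x - y) \<le> B"
    by (intro exI[of _ B] ballI B sub)
  moreover have "\<forall>x\<in>lim_ball z D s. \<forall>y\<in>lim_ball z D s. N (T x - T y) \<le> N (x - y)"
    by (intro ballI inv_setD(5)[OF D] sub)
  moreover have "lim_ball z D s \<subseteq> X" by (intro subsetI X sub)
  ultimately show ?thesis unfolding inv_set_def by (intro conjI ne conv inv)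
qed

text \<open>The left-hand side of the last hypothesis is the iterated limit, first in \<open>n\<close> and then in \<open>m\<close>, of
  \<open>\<rho> ((z n - v m)/s)\<close> for \<open>v m = (1 - t) z m + t u\<close>: the masses \<open>r\<close> of \<open>z n - x\<close> and
  \<open>(1 - t) r\<close> of \<open>(1 - t) (z m - x)\<close> add up. So \<open>v m\<close> is in the ball for large \<open>m\<close>.\<close>

lemma lim_ball_nonempty:
  assumes D: "inv_set T D" and z: "afps T D z x r" and u: "u \<in> D"
    and t: "0 \<le> t" "t < 1" and s: "0 < s"
    and lt: "(1/s) * ((2 - t) * r) + \<rho> ((1/s) *\<^sub>R (t *\<^sub>R (u - x))) < 1"
  shows "lim_ball z D s \<noteq> {}"
proof -
  note zD = afpsD(1)[OF z] and xX = afpsD(3)[OF z] and van = afpsD(4)[OF z]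
  note X = inv_setD(2)[OF D]
  define v where "v n = (1 - t) *\<^sub>R z n + t *\<^sub>R u" for n
  have vD: "v n \<in> D" for n unfolding v_def using t by (intro inv_set_comb[OF D] zD u) auto
  have c: "1/s > 0" using s by simp
  have ux: "t *\<^sub>R (u - x) \<in> X" using X u xX by (intro scale_mem diff_mem) auto
  have "v n - x = (1 - t) *\<^sub>R (z n - x) + t *\<^sub>R (u - x)" for n
    by (simp add: v_def scaleR_diff_right scaleR_left_diff_distrib)
  then have "(\<lambda>n. \<rho> ((1/s) *\<^sub>R (v n - x))) \<longlonglongrightarrow> (1/s) * ((1 - t) * r) + \<rho> ((1/s) *\<^sub>R (t *\<^sub>R (u - x)))"
    using rho_scaled_add_vanishing[OF vanishing_scale[OF van, of "1 - t"] ux c] t by simp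
  moreover have "(1/s) * ((1 - t) * r) + \<rho> ((1/s) *\<^sub>R (t *\<^sub>R (u - x))) < 1 - (1/s) * r"
    using lt by (simp add: left_diff_distrib diff_divide_distrib)
  ultimately have "\<forall>\<^sub>F n in sequentially. \<rho> ((1/s) *\<^sub>R (v n - x)) < 1 - (1/s) * r"
    by (rule order_tendstoD(2))
  then obtain m where m: "\<rho> ((1/s) *\<^sub>R (v m - x)) < 1 - (1/s) * r" by (auto simp: eventually_sequentially)
  have "v m \<in> lim_ball z D s"
    unfolding lim_ball_def
  proof (intro CollectI conjI allI impI vD)
    fix s' assume s': "s < s'"
    have xv: "x - v m \<in> X" by (intro diff_mem xX X vD)
    have "(\<lambda>n. \<rho> ((1/s) *\<^sub>R ((z n - x) + (x - v m)))) \<longlonglongrightarrow> (1/s) * r + \<rho> ((1/s) *\<^sub>R (x - v m))"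
      by (rule rho_scaled_add_vanishing[OF van xv c])
    moreover have "(1/s) * r + \<rho> ((1/s) *\<^sub>R (x - v m)) < 1"
      using m unfolding rho_diff_commute[of _ x] by simp
    ultimately have "\<forall>\<^sub>F n in sequentially. \<rho> ((1/s) *\<^sub>R ((z n - x) + (x - v m))) < 1"
      by (rule order_tendstoD(2))
    then show "\<forall>\<^sub>F n in sequentially. N (z n - v m) < s'"
    proof eventually_elim
      case (elim n)
      then have "N (z n - v m) \<le> s" by (intro N_le s diff_mem X zD vD) simp
      with s' show ?case by simp
    qed
  qed
  then show ?thesis by blast
qed

text \<open>The left-hand side is the iterated limit of \<open>\<rho> ((z n - y m)/s')\<close>, where the masses of
  \<open>z n - x\<close> and \<open>y m - w\<close> add up.\<close>

lemma lim_ball_limit_bound: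
  assumes D: "inv_set T D" and z: "afps T D z x r"
    and y: "\<And>m. y m \<in> lim_ball z D s" and wX: "w \<in> X" and vy: "vanishing (\<lambda>m. y m - w) q"
    and s: "0 < s'" "s < s'"
  shows "(1/s') * (r + q) + \<rho> ((1/s') *\<^sub>R (x - w)) \<le> 1"
proof -
  note zD = afpsD(1)[OF z] and xX = afpsD(3)[OF z] and van = afpsD(4)[OF z]
  note X = inv_setD(2)[OF D]
  have c: "1/s' > 0" using s by simp
  have yD: "y m \<in> D" for m using y lim_ball_subset[of z D s] by blast
  have 1: "(1/s') * r + \<rho> ((1/s') *\<^sub>R (x - y m)) \<le> 1" for m
  proof (rule tendsto_upperbound)
    show "(\<lambda>n. \<rho> ((1/s') *\<^sub>R ((z n - x) + (x - y m)))) \<longlonglongrightarrow> (1/s') * r + \<rho> ((1/s') *\<^sub>R (x - y m))"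
      by (rule rho_scaled_add_vanishing[OF van diff_mem[OF xX X[OF yD]] c])
    have "\<forall>\<^sub>F n in sequentially. N (z n - y m) < s'" using y[of m] s by (simp add: lim_ball_def)
    then show "\<forall>\<^sub>F n in sequentially. \<rho> ((1/s') *\<^sub>R ((z n - x) + (x - y m))) \<le> 1"
    proof eventually_elim
      case (elim n)
      then show ?case using rho_le_1[OF diff_mem[OF X[OF zD] X[OF yD]] elim] by simp
    qed
  qed simp
  have "(\<lambda>m. (1/s') * r + \<rho> ((1/s') *\<^sub>R ((y m - w) + (w - x)))) \<longlonglongrightarrow> (1/s') * r + ((1/s') * q + \<rho> ((1/s') *\<^sub>R (w - x)))"
    by (intro tendsto_add tendsto_const rho_scaled_add_vanishing[OF vy diff_mem[OF wX xX] c])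
  moreover have "(1/s') * r + \<rho> ((1/s') *\<^sub>R ((y m - w) + (w - x))) \<le> 1" for m
    using 1[of m] unfolding rho_diff_commute[of _ x] by simp
  ultimately have "(1/s') * r + ((1/s') * q + \<rho> ((1/s') *\<^sub>R (w - x))) \<le> 1"
    by (intro LIMSEQ_le_const2[of _ _ 1]) blast+
  then show ?thesis unfolding rho_diff_commute[of _ x] by (simp add: distrib_left add.assoc)
qed

section \<open>The infimum of the masses is zero\<close>

definition rad :: "((nat \<Rightarrow> real) \<Rightarrow> nat \<Rightarrow> real) \<Rightarrow> (nat \<Rightarrow> real) set \<Rightarrow> real" where
  "rad T D = Inf {r. \<exists>z x. afps T D z x r}"

lemma rad_le: "afps T D z x r \<Longrightarrow> rad T D \<le> r"
  unfolding rad_def by (intro cInf_lower bdd_belowI[of _ 0]) (auto dest: afpsD(4) intro: vanishing_nonneg)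

lemma rad_greatest:
  assumes "inv_set T D" "\<And>z x r. afps T D z x r \<Longrightarrow> b \<le> r" shows "b \<le> rad T D"
  unfolding rad_def using afps_exists[OF assms(1)] assms(2) by (intro cInf_greatest) auto

lemma rad_approx:
  assumes "inv_set T D" "rad T D < b" shows "\<exists>z x r. afps T D z x r \<and> r < b"
  using rad_greatest[OF assms(1), of b] assms(2) by (metis not_le)

text \<open>The choices are made in the order \<open>D\<close>, \<open>u\<close>, \<open>t\<close>, \<open>(z, x, r)\<close>. The precision to which \<open>r\<close> has to
  approximate the infimum over \<open>D\<close> depends on \<open>t\<close>, whereas \<open>t\<close> must work for the limit \<open>x\<close>. The
  estimates \<open>near\<close>, uniform over all limits of sequences in \<open>D\<close>, break this circle.\<close>

lemma rad_zero:
  assumes C: "inv_set T C"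
  shows "rad T C = 0"
proof (rule ccontr)
  define r0 where "r0 = rad T C"
  assume "rad T C \<noteq> 0"
  moreover have "0 \<le> rad T C"
    by (rule rad_greatest[OF C]) (rule vanishing_nonneg[OF afpsD(4)])
  ultimately have r0: "0 < r0" by (simp add: r0_def)
  \<comment> \<open>The factor \<open>6 powr P\<close> absorbs the rescaling from \<open>1/t\<close> to \<open>6/t\<close> in the estimates \<open>near\<close>.\<close>
  define d where "d = r0 / (8 * 6 powr P)"
  have six: "6 \<le> 6 powr P" using powr_mono[of 1 P 6] P_gt1 by simp
  have d: "0 < d" "48 * d \<le> r0" using r0 six by (auto simp: d_def field_simps)
  obtain z1 x1 r1 where z1: "afps T C z1 x1 r1" and r1: "r1 < r0 + d" "r0 \<le> r1"
    using rad_approx[OF C, of "r0 + d"] rad_le d unfolding r0_def by fastforce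
  define D where "D = lim_ball z1 C (2 * r1 + d)"
  have "D \<noteq> {}"
    unfolding D_def
  proof (rule lim_ball_nonempty[OF C z1 afpsD(1)[OF z1, of 0], of 0])
    show "1 / (2 * r1 + d) * ((2 - 0) * r1) + \<rho> ((1 / (2 * r1 + d)) *\<^sub>R 0 *\<^sub>R (z1 0 - x1)) < 1"
      using r0 r1 d by simp
  qed (use r0 r1 d in auto)
  then have D: "inv_set T D"
    unfolding D_def by (intro lim_ball_inv_set[OF C] afpsD[OF z1])
  have DC: "D \<subseteq> C" unfolding D_def by (rule lim_ball_subset)
  have x1X: "x1 \<in> X" by (rule afpsD(3)[OF z1])
  have near: "r0 \<le> r" "x \<in> X" "\<rho> ((2/s) *\<^sub>R (x1 - x)) \<le> 1/4"
    if z: "afps T D z x r" and s: "r0 \<le> s" for z x r s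
  proof -
    show r: "r0 \<le> r" unfolding r0_def by (rule rad_le[OF afps_mono[OF z DC]])
    show xX: "x \<in> X" by (rule afpsD(3)[OF z])
    \<comment> \<open>Any radius strictly above the one that defines \<open>D\<close>, of order \<open>d\<close> above \<open>2 * r0\<close>.\<close>
    define t where "t = 2 * r1 + 2 * d"
    have t: "0 < t" "2 * r1 + d < t" "2 * r0 \<le> t" "t \<le> 2 * r0 + 4 * d"
      using r0 r1 d by (auto simp: t_def)
    have v: "x1 - x \<in> X" by (rule diff_mem[OF x1X xX])
    have "1/t * (r1 + r) + \<rho> ((1/t) *\<^sub>R (x1 - x)) \<le> 1"
      using lim_ball_limit_bound[OF C z1 _ xX afpsD(4)[OF z] t(1,2)] afpsD(1)[OF z] unfolding D_def by blast
    moreover have "1/t * (2 * r0) \<le> 1/t * (r1 + r)" using t r r1 by (intro mult_left_mono) auto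
    ultimately have "\<rho> ((1/t) *\<^sub>R (x1 - x)) \<le> (t - 2 * r0) / t" using t by (simp add: diff_divide_distrib)
    also have "\<dots> \<le> (4 * d) / (2 * r0)" using t r0 d by (intro frac_le) auto
    also have "\<dots> = 1 / (4 * 6 powr P)" using r0 by (simp add: d_def)
    finally have 1: "\<rho> ((1/t) *\<^sub>R (x1 - x)) \<le> 1 / (4 * 6 powr P)" .
    have "2 / s \<le> 6 / t" using t d r0 s by (simp add: field_simps)
    then have "\<rho> ((2/s) *\<^sub>R (x1 - x)) \<le> \<rho> ((6/t) *\<^sub>R (x1 - x))"
      using r0 s by (intro rho_mono_scale v) auto
    also have "\<dots> = \<rho> (6 *\<^sub>R ((1/t) *\<^sub>R (x1 - x)))" by simp
    also have "\<dots> \<le> 6 powr P * \<rho> ((1/t) *\<^sub>R (x1 - x))" by (rule rho_stretch[OF scale_mem[OF v]]) simp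
    also have "\<dots> \<le> 6 powr P * (1 / (4 * 6 powr P))" by (rule mult_left_mono[OF 1]) simp
    also have "\<dots> = 1/4" by simp
    finally show "\<rho> ((2/s) *\<^sub>R (x1 - x)) \<le> 1/4" .
  qed
  obtain u where u: "u \<in> D" using inv_setD(1)[OF D] by blast
  have uX: "u \<in> X" by (rule inv_setD(2)[OF D u])
  have v: "u - x1 \<in> X" by (rule diff_mem[OF uX x1X])
  obtain t where t: "0 < t" "t < 1" "\<rho> (t *\<^sub>R ((2/r0) *\<^sub>R (u - x1))) \<le> 1/4 * t"
    using rho_sublinear_at_0[OF scale_mem[OF v, of "2/r0"], of "1/4"] by auto
  obtain z x r where z: "afps T D z x r" and r: "r < rad T D + t * r0 / 4"
    using rad_approx[OF D, of "rad T D + t * r0 / 4"] t r0 by auto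
  define s where "s = 2 * r * (1 - t/8)"
  have rr0: "r0 \<le> r" using near(1)[OF z order_refl] .
  have "r * 1 \<le> r * (2 * (1 - t/8))" using rr0 r0 t by (intro mult_left_mono) auto
  then have rs: "r \<le> s" by (simp add: s_def mult.assoc mult.left_commute)
  have s: "r0 \<le> s" "0 < s" using rr0 r0 rs by auto
  note xX = near(2)[OF z order_refl]
  define E where "E = lim_ball z D s"
  have "E \<noteq> {}"
    unfolding E_def
  proof (rule lim_ball_nonempty[OF D z u, of t])
    have mem: "(2/s) *\<^sub>R (x1 - x) \<in> X" "(2/s) *\<^sub>R (u - x1) \<in> X"
      by (intro scale_mem v diff_mem x1X xX)+
    \<comment> \<open>Splitting at \<open>x1\<close>: closeness to \<open>x1\<close> controls one half, the choice of \<open>t\<close> the other.\<close>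
    have "(1/s) *\<^sub>R (t *\<^sub>R (u - x)) = (1 - 1/2) *\<^sub>R (t *\<^sub>R ((2/s) *\<^sub>R (x1 - x))) + (1/2) *\<^sub>R (t *\<^sub>R ((2/s) *\<^sub>R (u - x1)))"
      by (simp add: scaleR_diff_right)
    then have "\<rho> ((1/s) *\<^sub>R (t *\<^sub>R (u - x))) \<le> (1 - 1/2) * \<rho> (t *\<^sub>R ((2/s) *\<^sub>R (x1 - x))) + (1/2) * \<rho> (t *\<^sub>R ((2/s) *\<^sub>R (u - x1)))"
      using convex_comb_mem_rho(2)[OF scale_mem[OF mem(1), of t] scale_mem[OF mem(2), of t], of "1/2"] by simp
    moreover have "\<rho> (t *\<^sub>R ((2/s) *\<^sub>R (x1 - x))) \<le> t * (1/4)"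
      using rho_shrink[OF mem(1), of t] mult_left_mono[OF near(3)[OF z s(1)], of t] t by linarith
    moreover have "\<rho> (t *\<^sub>R ((2/s) *\<^sub>R (u - x1))) \<le> 1/4 * t"
    proof -
      have "\<rho> ((t * (2/s)) *\<^sub>R (u - x1)) \<le> \<rho> ((t * (2/r0)) *\<^sub>R (u - x1))"
        using s r0 t by (intro rho_mono_scale v mult_left_mono divide_left_mono) auto
      with t(3) show ?thesis by simp
    qed
    moreover have "(1 - 1/2) * a + (1/2) * b \<le> t/4" if "a \<le> t * (1/4)" "b \<le> 1/4 * t" for a b
      using that by simp
    ultimately have 1: "\<rho> ((1/s) *\<^sub>R (t *\<^sub>R (u - x))) \<le> t/4" by (meson order_trans)
    have "(1/s) * ((2 - t) * r) = (1 - t/2) / (1 - t/8)"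
      using r0 rr0 t by (simp add: s_def field_simps)
    also have "\<dots> < 1 - t/4"
    proof -
      have "(1 - t/4) * (1 - t/8) = 1 - t/2 + t/8 + t * t/32" by (simp add: field_simps)
      moreover have "0 < t * t" using t(1) by simp
      ultimately have "1 - t/2 < (1 - t/4) * (1 - t/8)" using t(1) by linarith
      then show ?thesis using t by (simp add: divide_less_eq)
    qed
    finally show "1 / s * ((2 - t) * r) + \<rho> ((1 / s) *\<^sub>R t *\<^sub>R (u - x)) < 1" using 1 by linarith
  qed (use t s in auto)
  then have E: "inv_set T E" unfolding E_def by (intro lim_ball_inv_set[OF D] afpsD[OF z])
  have ED: "E \<subseteq> D" unfolding E_def by (rule lim_ball_subset)
  obtain y w q where y: "afps T E y w q" using afps_exists[OF E] by blast
  \<comment> \<open>The masses \<open>r\<close> and \<open>q\<close> share the radius \<open>s\<close>, which leaves at most \<open>r - t * r/4\<close> for \<open>q\<close>.\<close>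
  have "r + q \<le> s'" if s': "s < s'" for s'
  proof -
    have pos: "0 < s'" using s s' by simp
    have "1/s' * (r + q) + \<rho> ((1/s') *\<^sub>R (x - w)) \<le> 1"
      using lim_ball_limit_bound[OF D z _ afpsD(3,4)[OF y] pos s'] afpsD(1)[OF y] unfolding E_def by blast
    moreover have "0 \<le> \<rho> ((1/s') *\<^sub>R (x - w))"
      by (intro rho_nonneg scale_mem diff_mem xX afpsD(3)[OF y])
    ultimately have "1/s' * (r + q) \<le> 1" by linarith
    then show ?thesis using pos by (simp add: field_simps)
  qed
  then have "r + q \<le> s" by (rule dense_ge)
  then have "q \<le> r - t * r / 4" by (simp add: s_def algebra_simps)
  also have "\<dots> \<le> r - t * r0 / 4" using t rr0 by (simp add: mult_left_mono)
  also have "\<dots> < rad T D" using r by simp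
  also have "\<dots> \<le> q" by (rule rad_le[OF afps_mono[OF y ED]])
  finally show False by simp
qed

section \<open>The fixed point\<close>

text \<open>An asymptotic ball around a sequence of mass \<open>r\<close> is nonempty as soon as its radius exceeds
  \<open>2 r\<close>, and its diameter is at most twice its radius.\<close>

lemma small_inv_subset:
  assumes C: "inv_set T C" and e: "0 < e"
  shows "\<exists>D. inv_set T D \<and> D \<subseteq> C \<and> (\<forall>x\<in>D. \<forall>y\<in>D. N (x - y) < e)"
proof -
  obtain z x r where z: "afps T C z x r" and r: "r < e/8"
    using rad_approx[OF C, of "e/8"] rad_zero[OF C] e by auto
  define D where "D = lim_ball z C (e/4)"
  have "D \<noteq> {}"
    unfolding D_def
  proof (rule lim_ball_nonempty[OF C z afpsD(1)[OF z, of 0], of 0])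
    show "1 / (e/4) * ((2 - 0) * r) + \<rho> ((1 / (e/4)) *\<^sub>R 0 *\<^sub>R (z 0 - x)) < 1"
      using e r by simp
  qed (use e in auto)
  then have D: "inv_set T D" unfolding D_def by (intro lim_ball_inv_set[OF C] afpsD[OF z])
  have "N (x - y) < e" if xy: "x \<in> D" "y \<in> D" for x y
  proof -
    have "\<forall>\<^sub>F n in sequentially. N (z n - x) < e/2" "\<forall>\<^sub>F n in sequentially. N (z n - y) < e/2"
      using xy e unfolding D_def lim_ball_def by (auto dest!: spec[of _ "e/2"])
    then have "\<forall>\<^sub>F n in sequentially. N (x - y) < e"
    proof eventually_elim
      case (elim n)
      have mem: "x \<in> X" "y \<in> X" "z n \<in> X" using inv_setD(2)[OF D] xy inv_setD(2)[OF C afpsD(1)[OF z]] by auto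
      show ?case using N_diff_triangle[OF mem(1,3,2)] N_diff_commute[OF mem(1,3)] elim by linarith
    qed
    then show ?thesis by simp
  qed
  with D show ?thesis using lim_ball_subset[of z C "e/4"] unfolding D_def by blast
qed

text \<open>In nested invariant sets with diameters tending to 0, any selection of points converges to a
  fixed point, since \<open>y n\<close> and \<open>T (y n)\<close> lie in the same small set.\<close>

lemma fixed_point:
  assumes C: "inv_set T C"
    and closed: "\<And>y x. (\<And>n. y n \<in> C) \<Longrightarrow> x \<in> X \<Longrightarrow> (\<lambda>n. N (y n - x)) \<longlonglongrightarrow> 0 \<Longrightarrow> x \<in> C"
  shows "\<exists>x\<in>C. T x = x"
proof -
  define Q where "Q n D \<longleftrightarrow> inv_set T D \<and> D \<subseteq> C \<and> (\<forall>x\<in>D. \<forall>y\<in>D. N (x - y) < 1 / real (Suc n))" for n D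
  have "\<exists>D. \<forall>n. Q n (D n) \<and> D (Suc n) \<subseteq> D n"
  proof (rule dependent_nat_choice)
    show "\<exists>D. Q 0 D" unfolding Q_def using small_inv_subset[OF C, of "1 / real (Suc 0)"] by auto
    show "\<exists>D'. Q (Suc n) D' \<and> D' \<subseteq> D" if "Q n D" for D n
    proof -
      have "inv_set T D" "D \<subseteq> C" using that by (simp_all add: Q_def)
      with small_inv_subset[of T D "1 / real (Suc (Suc n))"] obtain D'
        where "inv_set T D'" "D' \<subseteq> D" "\<forall>x\<in>D'. \<forall>y\<in>D'. N (x - y) < 1 / real (Suc (Suc n))" by auto
      with \<open>D \<subseteq> C\<close> show ?thesis unfolding Q_def by blast
    qed
  qed
  then obtain D where Q: "\<And>n. Q n (D n)" and sub: "\<And>n. D (Suc n) \<subseteq> D n" by blast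
  have inv: "inv_set T (D n)" and DC: "D n \<subseteq> C"
    and diam: "x \<in> D n \<Longrightarrow> y \<in> D n \<Longrightarrow> N (x - y) < 1 / real (Suc n)" for n x y
    using Q[of n] by (simp_all add: Q_def)
  have mono: "D n \<subseteq> D m" if "m \<le> n" for m n
    using that by (rule lift_Suc_antimono_le[of D, OF sub])
  have "\<forall>n. \<exists>y. y \<in> D n" using inv_setD(1)[OF inv] by blast
  then obtain y where y: "\<And>n. y n \<in> D n" by metis
  have yX: "y n \<in> X" for n by (rule inv_setD(2)[OF inv y])
  obtain x where x: "x \<in> X" "(\<lambda>n. N (y n - x)) \<longlonglongrightarrow> 0"
  proof -
    have "\<exists>M. \<forall>m\<ge>M. \<forall>n\<ge>M. N (y m - y n) < e" if e: "e > 0" for e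
    proof -
      obtain M where M: "1 / real (Suc M) < e" using nat_approx_posE[OF e] by blast
      have "N (y m - y n) < e" if "m \<ge> M" "n \<ge> M" for m n
        using diam[of "y m" M "y n"] y[of m] y[of n] mono[OF that(1)] mono[OF that(2)] M by fastforce
      then show ?thesis by blast
    qed
    from complete_X[OF yX this] that show ?thesis by blast
  qed
  have xC: "x \<in> C" by (rule closed[OF _ x]) (use y DC in blast)
  have TxX: "T x \<in> X" by (rule inv_setD(2)[OF C inv_setD(4)[OF C xC]])
  have bound: "N (T x - x) \<le> 2 * N (y n - x) + 1 / real (Suc n)" for n
  proof -
    have yC: "y n \<in> C" using y DC by blast
    have Ty: "T (y n) \<in> D n" by (rule inv_setD(4)[OF inv y])
    have TyX: "T (y n) \<in> X" by (rule inv_setD(2)[OF inv Ty])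
    have "N (T x - x) \<le> N (T x - T (y n)) + N (T (y n) - x)" by (rule N_diff_triangle[OF TxX TyX x(1)])
    moreover have "N (T (y n) - x) \<le> N (T (y n) - y n) + N (y n - x)" by (rule N_diff_triangle[OF TyX yX x(1)])
    moreover have "N (T x - T (y n)) \<le> N (y n - x)"
      using inv_setD(5)[OF C xC yC] N_diff_commute[OF x(1) yX[of n]] by simp
    moreover have "N (T (y n) - y n) < 1 / real (Suc n)" by (rule diam[OF Ty y])
    ultimately show ?thesis by linarith
  qed
  have "(\<lambda>n. 2 * N (y n - x) + 1 / real (Suc n)) \<longlonglongrightarrow> 2 * 0 + 0"
    by (intro tendsto_add tendsto_mult tendsto_const x(2) LIMSEQ_Suc[OF lim_1_over_n])
  then have "N (T x - x) \<le> 2 * 0 + 0"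
    by (rule LIMSEQ_le_const) (use bound in blast)
  then have "N (T x - x) = 0" using N_nonneg[OF diff_mem[OF TxX x(1)]] by simp
  then have "T x - x = 0" using normed_on_X diff_mem[OF TxX x(1)] unfolding normed_on_def by blast
  with xC show ?thesis by auto
qed

lemma has_FPP_nakano: "has_FPP X N"
  unfolding has_FPP_def
proof (intro conjI allI impI banach_on_X, elim conjE)
  interpret Metric_space X "norm_dist X N" by (rule Metric_space_norm_dist[OF normed_on_X])
  fix C T
  assume ne: "C \<noteq> {}" and cl: "closedin mtopology C" and conv: "convex C"
    and bd: "mbounded C" and T: "T \<in> C \<rightarrow> C"
    and nonexp: "\<forall>x\<in>C. \<forall>y\<in>C. N (T x - T y) \<le> N (x - y)"
  have CX: "C \<subseteq> X" using cl closedin_subset by fastforce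
  obtain B where "\<forall>x\<in>C. \<forall>y\<in>C. norm_dist X N x y \<le> B" using bd unfolding mbounded_alt by blast
  then have "\<forall>x\<in>C. \<forall>y\<in>C. N (x - y) \<le> B" using CX by (auto simp: norm_dist_def subset_iff)
  then have C: "inv_set T C"
    unfolding inv_set_def using ne CX conv T nonexp by blast
  show "\<exists>x\<in>C. T x = x"
  proof (rule fixed_point[OF C])
    fix y x assume y: "\<And>n. y n \<in> C" and x: "x \<in> X" and lim: "(\<lambda>n. N (y n - x)) \<longlonglongrightarrow> 0"
    have yX: "y n \<in> X" for n using y CX by blast
    have "limitin mtopology y x sequentially"
      using x lim yX by (simp add: limitin_metric_dist_null norm_dist_def)
    then show "x \<in> C" using cl y unfolding metric_closedin_iff_sequentially_closed by blast
  qed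
qed

end

theorem corollary4p7:
  fixes p :: "nat \<Rightarrow> real"
  assumes "\<And>n. 1 < p n"
    and "p \<longlonglongrightarrow> 1"
  shows "has_FPP (nakano_space p) (luxemburg_norm p)"
proof -
  interpret nakano_to_one p by unfold_locales (use assms in auto)
  show ?thesis by (rule has_FPP_nakano)
qed

end
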